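(* For $n \ge 0$, let $\pi \in \mathfrak{S}_{n+1}(1243,2143)$. Then $\pi' = \mathrm{rc}(\pi)$ lies in $\mathfrak{S}_{n+1}(1243,2143)$ if and only if $p = \varphi^{-1}(\pi) \in \mathcal{D}_n$. Furthermore, if $p \in \mathcal{D}_n$, then $\varphi^{-1}(\pi') = p'$ where $p' = \mathrm{rev}(\psi(p))$.
   Context: Permutations. $\mathfrak{S}_m$ is the set of permutations of $\{1,\ldots,m\}$, written in one-line notation $(\pi(1),\ldots,\pi(m))$; $\mathfrak{S}_m(1243,2143)$ is the set of those having no subsequence order-isomorphic to $1243$ or to $2143$. The reverse-complement of $\pi\in\mathfrak{S}_m$ is $\mathrm{rc}(\pi)=\pi'$ with $\pi'(i)=(m+1)-\pi(m+1-i)$ for $i=1,\ldots,m$. Schröder paths. A Schröder path of length $n\ge 1$ is a lattice path from $(0,0)$ to $(n,n)$ with steps from $\{\mathsf{e}=(1,0),\ \mathsf{n}=(0,1),\ \mathsf{d}=(1,1)\}$ that does not pass below the line $y=x$; it is written as a word in these letters. $\mathcal{S}_n$ is the set of Schröder paths of length $n$, and $\mathcal{S}_0$ contains only the empty path $\emptyset$. Juxtaposition denotes concatenation. The set $\mathcal{D}_n$. $\mathcal{P}$ is the set of paths formed by concatenating a finite (possibly empty) sequence of elements of $\{\mathsf{d}\}\cup\{\mathsf{n}^k\mathsf{e}^k : k>0\}$. $\mathcal{D}_n\subseteq\mathcal{S}_n$ is the set of Schröder paths of length $n$ formed by concatenating a finite (possibly empty) sequence of elements of $\{\mathsf{d}\}\cup\{\mathsf{n}\,q\,\mathsf{e}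 : q\in\mathcal{P}\}$. Features, $\psi$ and $\mathrm{rev}$. For $t\in\{1,\ldots,n-1\}$, $p\in\mathcal{S}_n$ has a level feature at $t$ if it contains a $\mathsf{d}$ step joining $(t-1,t)$ to $(t,t+1)$, and a notch feature at $t$ if it contains $\mathsf{e}\mathsf{n}$ joining $(t-1,t)$ to $(t,t)$ to $(t,t+1)$. $\psi(p)$ is the path obtained from $p$ by replacing all level features at $t\in\{1,\ldots,n-1\}$ by notch features at $t$ and vice versa (simultaneously). $\mathrm{rev}(p)$ is the path obtained by applying the steps of $p$ in reverse order and then replacing every $\mathsf{e}$ by $\mathsf{n}$ and vice versa. The Egge–Mansour bijection $\varphi:\mathcal{S}_n\to\mathfrak{S}_{n+1}(1243,2143)$ (known to be a bijection). For $i=1,\ldots,n$ let $s_i$ act on a one-line permutation by exchanging the entries in positions $i$ and $i+1$; products act right to left: $s_is_j\pi=s_i(s_j(\pi))$. Given $p\in\mathcal{S}_n$: let $\Gamma_{r,s}$ be the unit square with opposite corners $(r-1,s-1)$ and $(r,s)$. Label by $r$ each $\Gamma_{r,s}$ whose top-left corner $(r-1,s)$ lies on or below $p$ and strictly above the line $y=x$. Successively for $i=1,2,\ldots$, as long as labeled squares remain: take the labeled square $\Gamma_{r,s}$ with largest label $r$ and move diagonally to the lower left through $\Gamma_{r,s},\Gamma_{r-1,s-1},\ldots$, stopping at the first square $\Gamma_{r-j,s-j}$ whose left side is an $\mathsf{n}$ step of $p$; set $\sigma_i=s_rs_{r-1}\cdots s_{r-j}$ and remove the labels used. If $\sigma_1,\ldots,\sigma_k$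 are the products obtained, then $\varphi(p)=\sigma_k\sigma_{k-1}\cdots\sigma_1(n+1,n,\ldots,2,1)$. (For example $\varphi(\mathsf{d})=(2,1)$, $\varphi(\mathsf{n}\mathsf{e})=(1,2)$, and $\varphi(\emptyset)=(1)$.) *)

theory Defs
  imports "HOL-Combinatorics.Combinatorics"
begin

text \<open>A permutation of \<open>{1..m}\<close> is a function \<open>\<pi> :: nat \<Rightarrow> nat\<close> with \<open>\<pi> permutes {1..m}\<close>;
  its one-line notation is \<open>(\<pi> 1, \<dots>, \<pi> m)\<close>.  A pattern is given in one-line notation as a list.\<close>

definition contains_pattern :: "nat \<Rightarrow> (nat \<Rightarrow> nat) \<Rightarrow> nat list \<Rightarrow> bool" where
  "contains_pattern m \<pi> \<tau> \<longleftrightarrow>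
     (\<exists>f. strict_mono_on {..<length \<tau>} f \<and> f ` {..<length \<tau>} \<subseteq> {1..m} \<and>
        (\<forall>a<length \<tau>. \<forall>b<length \<tau>. \<pi> (f a) < \<pi> (f b) \<longleftrightarrow> \<tau> ! a < \<tau> ! b))"

definition schroeder_perms :: "nat \<Rightarrow> (nat \<Rightarrow> nat) set" where
  "schroeder_perms m = {\<pi>. \<pi> permutes {1..m} \<and>
     \<not> contains_pattern m \<pi> [1,2,4,3] \<and> \<not> contains_pattern m \<pi> [2,1,4,3]}"

definition rc :: "nat \<Rightarrow> (nat \<Rightarrow> nat) \<Rightarrow> nat \<Rightarrow> nat" where
  "rc m \<pi> = (\<lambda>i. if i \<in> {1..m} then (m + 1) - \<pi> (m + 1 - i) else i)"

datatype step = E | N | D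

type_synonym path = "step list"

text \<open>The end point of a path that starts at \<open>(0,0)\<close>.\<close>

definition endpoint :: "path \<Rightarrow> nat \<times> nat" where
  "endpoint p = (count_list p E + count_list p D, count_list p N + count_list p D)"

text \<open>Every step either stays on one side of the line \<open>y = x\<close> or touches it at a lattice point,
  so it suffices to look at the lattice points visited by the path.\<close>

definition schroeder_paths :: "nat \<Rightarrow> path set" where
  "schroeder_paths n = {p. endpoint p = (n, n) \<and>
     (\<forall>i\<le>length p. fst (endpoint (take i p)) \<le> snd (endpoint (take i p)))}"

definition has_step_at :: "path \<Rightarrow> step \<Rightarrow> nat \<times> nat \<Rightarrow> bool" where
  "has_step_at p c P \<longleftrightarrow> (\<exists>i<length p. p ! i = c \<and> endpoint (take i p) = P)"

definition on_or_below :: "nat \<times> nat \<Rightarrow> path \<Rightarrow> bool" where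
  "on_or_below P p \<longleftrightarrow>
     (\<exists>i\<le>length p. fst (endpoint (take i p)) = fst P \<and> snd P \<le> snd (endpoint (take i p)))"

definition P_paths :: "path set" where
  "P_paths = {concat ws | ws. set ws \<subseteq> {[D]} \<union> {replicate k N @ replicate k E | k. k > 0}}"

definition D_paths :: "nat \<Rightarrow> path set" where
  "D_paths n = {p \<in> schroeder_paths n.
     \<exists>ws. set ws \<subseteq> {[D]} \<union> {[N] @ q @ [E] | q. q \<in> P_paths} \<and> p = concat ws}"

text \<open>\<open>psi_from n x y w\<close> replaces the features in the remaining part \<open>w\<close> of a path of length \<open>n\<close>,
  where \<open>w\<close> starts at the point \<open>(x, y)\<close>.  With \<open>t = x + 1\<close>, a step \<open>D\<close> starting at
  \<open>(x, y) = (t - 1, t)\<close> is a level feature at \<open>t\<close>, and steps \<open>E\<close>, \<open>N\<close> starting there form a notch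
  feature at \<open>t\<close>.  Distinct features have no step in common, so a single pass amounts to simultaneous
  replacement.\<close>

fun psi_from :: "nat \<Rightarrow> nat \<Rightarrow> nat \<Rightarrow> path \<Rightarrow> path" where
  "psi_from n x y [] = []"
| "psi_from n x y (D # w) =
     (if y = x + 1 \<and> x + 1 \<in> {1..n - 1} then E # N # psi_from n (x + 1) (y + 1) w
      else D # psi_from n (x + 1) (y + 1) w)"
| "psi_from n x y (E # N # w) =
     (if y = x + 1 \<and> x + 1 \<in> {1..n - 1} then D # psi_from n (x + 1) (y + 1) w
      else E # psi_from n (x + 1) y (N # w))"
| "psi_from n x y (E # w) = E # psi_from n (x + 1) y w"
| "psi_from n x y (N # w) = N # psi_from n x (y + 1) w"

definition psi :: "nat \<Rightarrow> path \<Rightarrow> path" where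
  "psi n p = psi_from n 0 0 p"

fun swap_step :: "step \<Rightarrow> step" where
  "swap_step E = N"
| "swap_step N = E"
| "swap_step D = D"

definition rev_path :: "path \<Rightarrow> path" where
  "rev_path p = map swap_step (rev p)"

definition adj_swap :: "nat \<Rightarrow> (nat \<Rightarrow> nat) \<Rightarrow> (nat \<Rightarrow> nat)" where
  "adj_swap i \<pi> = \<pi> \<circ> Transposition.transpose i (i + 1)"

text \<open>The pair \<open>(r, s)\<close> stands for the unit square with opposite corners \<open>(r - 1, s - 1)\<close> and \<open>(r, s)\<close>;
  if it is labeled, its label is \<open>r\<close>.\<close>

definition labeled_squares :: "path \<Rightarrow> (nat \<times> nat) set" where
  "labeled_squares p = {(r, s). r \<ge> 1 \<and> s \<ge> 1 \<and> on_or_below (r - 1, s) p \<and> r - 1 < s}"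

definition left_side_N :: "path \<Rightarrow> nat \<times> nat \<Rightarrow> bool" where
  "left_side_N p sq \<longleftrightarrow> has_step_at p N (fst sq - 1, snd sq - 1)"

text \<open>\<open>sigmas p L\<close> is the list \<open>[\<sigma>\<^sub>1, \<dots>, \<sigma>\<^sub>k]\<close> obtained from the set \<open>L\<close> of remaining labeled squares,
  where the product \<open>s\<^sub>r s\<^sub>r\<^sub>-\<^sub>1 \<dots>\<close> is given as the list \<open>[r, r - 1, \<dots>]\<close> of its indices.
  For Schroeder paths, the square with the largest remaining label is always unique, so the maximum in
  the choice of \<open>s\<close> only serves to make the function total.\<close>

function sigmas :: "path \<Rightarrow> (nat \<times> nat) set \<Rightarrow> nat list list" where
  "sigmas p L =
     (if finite L \<and> L \<noteq> {} then
        (let r = Max (fst ` L);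
             s = Max {s. (r, s) \<in> L};
             j = (LEAST j. left_side_N p (r - j, s - j))
         in rev [r - j..<r + 1] # sigmas p (L - {(r - i, s - i) | i. i \<le> j}))
      else [])"
  by pat_completeness auto

termination
proof (relation "measure (\<lambda>(p, L). card L)")
  fix p :: path and L :: "(nat \<times> nat) set" and r s j :: nat
  assume L: "finite L \<and> L \<noteq> {}" and r: "r = Max (fst ` L)" and s: "s = Max {s. (r, s) \<in> L}"
  have "r \<in> fst ` L"
    unfolding r using L by (intro Max_in) auto
  then have ne: "{s. (r, s) \<in> L} \<noteq> {}"
    by auto
  have "{s. (r, s) \<in> L} \<subseteq> snd ` L"
    by force
  then have "finite {s. (r, s) \<in> L}"
    using L finite_subset by blast
  with ne have "s \<in> {s. (r, s) \<in> L}"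
    unfolding s by (intro Max_in)
  then have "(r, s) \<in> L \<inter> {(r - i, s - i) | i. i \<le> j}"
    by force
  then have "L - {(r - i, s - i) | i. i \<le> j} \<subset> L"
    by blast
  with L show "((p, L - {(r - i, s - i) | i. i \<le> j}), (p, L)) \<in> measure (\<lambda>(p, L). card L)"
    by (auto intro: psubset_card_mono)
qed simp

declare sigmas.simps [simp del]

text \<open>Products act right to left: \<open>act [i, j, k] \<pi>\<close> is \<open>s\<^sub>i (s\<^sub>j (s\<^sub>k \<pi>))\<close>.\<close>

definition act :: "nat list \<Rightarrow> (nat \<Rightarrow> nat) \<Rightarrow> (nat \<Rightarrow> nat)" where
  "act ks \<pi> = foldr adj_swap ks \<pi>"

definition decreasing_perm :: "nat \<Rightarrow> nat \<Rightarrow> nat" where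
  "decreasing_perm m = (\<lambda>i. if i \<in> {1..m} then m + 1 - i else i)"

definition phi :: "nat \<Rightarrow> path \<Rightarrow> (nat \<Rightarrow> nat)" where
  "phi n p = act (concat (rev (sigmas p (labeled_squares p)))) (decreasing_perm (n + 1))"

definition phi_inv :: "nat \<Rightarrow> (nat \<Rightarrow> nat) \<Rightarrow> path" where
  "phi_inv n = inv_into (schroeder_paths n) (phi n)"

end

theory Submission
  imports Defs "HOL-Library.Sublist"
begin

text \<open>Write the columns of a Schroeder path as \<open>1, \<dots>, n\<close>, column \<open>b\<close> being entered by the step that
  ends at \<open>x = b\<close>. Reading \<open>N\<close> as an opening and \<open>E\<close> as a closing bracket, give column \<open>b\<close> the
  number \<open>c\<^sub>b\<close>: the \<open>x\<close>-coordinate of the matching \<open>N\<close> step if the column is entered by an \<open>E\<close> step,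
  and \<open>b\<close> itself if it is entered by a \<open>D\<close> step. The whole proof rests on one observation: \<open>phi n p\<close>
  is the permutation whose Lehmer code (the number of larger entries to the left of each position)
  is \<open>0, c\<^sub>1, \<dots>, c\<^sub>n\<close>. The labeled squares split into diagonal strips, one for each matched pair of an
  \<open>N\<close> and an \<open>E\<close> step (\<open>squares_decompose\<close>); the strip of the \<open>E\<close> step into column \<open>b\<close> gives the
  factor that moves the entry at position \<open>c\<^sub>b + 1\<close> to position \<open>b + 1\<close> (\<open>sigmas_closed_squares\<close>,
  \<open>lehmer_act_sigma_indices\<close>). The factors act in the order of decreasing \<open>b\<close>, and the entries still
  to be placed are always in decreasing order, so the entry placed at \<open>b + 1\<close> has exactly \<open>c\<^sub>b\<close>
  larger ones before it.

  Bracket matchings are noncrossing: \<open>c\<^sub>b\<^sub>' < b < b'\<close> implies \<open>c\<^sub>b\<^sub>' \<le> c\<^sub>b\<close>, and each such sequence comes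
  from exactly one path. For a Lehmer code the same condition says that the permutation avoids
  \<open>1243\<close> and \<open>2143\<close> (\<open>schroeder_perms_iff_noncrossing\<close>). Hence \<open>phi\<close> is a bijection onto the
  permutations avoiding these two patterns.

  If \<open>rc \<pi>\<close> avoids the patterns too, then \<open>\<pi>\<close> avoids \<open>2134\<close>, the reverse-complement of \<open>1243\<close>. For
  the code this excludes \<open>c\<^sub>i > c\<^sub>j \<ge> c\<^sub>k\<close> with \<open>i < j < k\<close> (\<open>rc_avoids_imp_shallow\<close>). A \<open>D\<close> step, or
  an \<open>E\<close> step followed by an \<open>N\<close> step, that lies at height at least two above the diagonal lies
  under two open brackets and produces such a triple; a Schroeder path without these is in \<open>D_paths\<close>
  (\<open>shallow_imp_D_blocks\<close>).

  For the converse and the formula for \<open>rc\<close>, the passage from \<open>p\<close> to \<open>p' = rev_path (psi n p)\<close> is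
  followed while \<open>p \<in> D_paths n\<close> is built up from left to right out of a few elementary pieces. Then
  \<open>p'\<close> is built up from right to left, each piece being replaced by its dual: \<open>D\<close> and \<open>E N\<close> on the
  line \<open>y = x + 1\<close> are exchanged, peaks and \<open>D\<close> steps on the diagonal are kept (\<open>dual_eq_rev_psi\<close>).
  A \<open>D\<close> step on the diagonal amounts to a skew sum of words, a notion that \<open>rc\<close> respects. Each other
  piece acts on a word by inserting new entries near the end just above the minimum, or a new
  minimum; negating and reversing the word turns this into inserting entries near the front just
  below the maximum, or a new maximum, which is what the dual piece does to the code. So there is a
  word with the code of \<open>p\<close> whose reversed negative has the code of \<open>p'\<close> (\<open>dual_realizes\<close>). As a
  permutation is determined by its Lehmer code, \<open>phi n p' = rc (n + 1) (phi n p)\<close>.\<close>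

section \<open>The code of a path\<close>

text \<open>The list \<open>c\<^sub>x\<^sub>+\<^sub>1, c\<^sub>x\<^sub>+\<^sub>2, \<dots>\<close> of a path \<open>w\<close> that starts in column \<open>x\<close> while the \<open>N\<close> steps at the
  \<open>x\<close>-coordinates \<open>st\<close> (innermost first) are still unmatched.\<close>

fun path_code :: "nat \<Rightarrow> nat list \<Rightarrow> path \<Rightarrow> nat list" where
  "path_code x st [] = []"
| "path_code x st (N # w) = path_code x (x # st) w"
| "path_code x st (E # w) = hd st # path_code (x + 1) (tl st) w"
| "path_code x st (D # w) = (x + 1) # path_code (x + 1) st w"

fun stack_after :: "nat \<Rightarrow> nat list \<Rightarrow> path \<Rightarrow> nat list" where
  "stack_after x st [] = st"
| "stack_after x st (N # w) = stack_after x (x # st) w"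
| "stack_after x st (E # w) = stack_after (x + 1) (tl st) w"
| "stack_after x st (D # w) = stack_after (x + 1) st w"

text \<open>A triple \<open>(a, b, k)\<close> stands for a matched pair: an \<open>N\<close> step starting at \<open>(a, a + k)\<close> and an
  \<open>E\<close> step ending at \<open>(b, b + k)\<close>.\<close>

fun arcs :: "nat \<Rightarrow> nat list \<Rightarrow> path \<Rightarrow> (nat \<times> nat \<times> nat) list" where
  "arcs x st [] = []"
| "arcs x st (N # w) = arcs x (x # st) w"
| "arcs x st (E # w) = (hd st, x + 1, length st - 1) # arcs (x + 1) (tl st) w"
| "arcs x st (D # w) = arcs (x + 1) st w"

text \<open>The path, started at height \<open>h\<close> above the diagonal, stays weakly above the diagonal and ends
  on it; so every bracket, including \<open>h\<close> earlier ones, gets closed.\<close>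

fun closes :: "nat \<Rightarrow> path \<Rightarrow> bool" where
  "closes h [] = (h = 0)"
| "closes h (N # w) = closes (h + 1) w"
| "closes h (E # w) = (h > 0 \<and> closes (h - 1) w)"
| "closes h (D # w) = closes h w"

lemma code_append:
  "path_code x st (u @ v) = path_code x st u @ path_code (x + length (path_code x st u))
    (stack_after x st u) v"
  by (induction x st u rule: path_code.induct) auto

lemma stack_after_append:
  "stack_after x st (u @ v) = stack_after (x + length (path_code x st u)) (stack_after x st u) v"
  by (induction x st u rule: path_code.induct) auto

lemma arcs_append:
  "arcs x st (u @ v) = arcs x st u @ arcs (x + length (path_code x st u)) (stack_after x st u) v"
  by (induction x st u rule: path_code.induct) auto

lemma endpoint_Nil [simp]: "endpoint [] = (0, 0)"
  by (simp add: endpoint_def)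

lemma endpoint_append:
  "endpoint (u @ v) = (fst (endpoint u) + fst (endpoint v), snd (endpoint u) + snd (endpoint v))"
  by (simp add: endpoint_def)

lemma endpoint_Cons:
  "endpoint (N # w) = (fst (endpoint w), Suc (snd (endpoint w)))"
  "endpoint (E # w) = (Suc (fst (endpoint w)), snd (endpoint w))"
  "endpoint (D # w) = (Suc (fst (endpoint w)), Suc (snd (endpoint w)))"
  by (auto simp: endpoint_def)

lemma length_code: "length (path_code x st w) = fst (endpoint w)"
  by (induction x st w rule: path_code.induct) (auto simp: endpoint_def)

lemma prefixes_above_Cons:
  "(\<forall>i\<le>Suc (length w). fst (endpoint (take i (s # w))) \<le> h + snd (endpoint (take i (s # w)))) \<longleftrightarrow>
     (\<forall>i\<le>length w. fst (endpoint (s # take i w)) \<le> h + snd (endpoint (s # take i w)))"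
  (is "?l = ?r")
proof
  assume ?l
  show ?r
  proof (intro allI impI)
    fix i assume "i \<le> length w"
    with \<open>?l\<close>[rule_format, of "Suc i"]
    show "fst (endpoint (s # take i w)) \<le> h + snd (endpoint (s # take i w))" by simp
  qed
next
  assume r: ?r
  show ?l
  proof (intro allI impI)
    fix i assume "i \<le> Suc (length w)"
    with r show "fst (endpoint (take i (s # w))) \<le> h + snd (endpoint (take i (s # w)))"
      by (cases i) auto
  qed
qed

lemma closes_iff:
  "closes h w \<longleftrightarrow> fst (endpoint w) = h + snd (endpoint w) \<and>
     (\<forall>i\<le>length w. fst (endpoint (take i w)) \<le> h + snd (endpoint (take i w)))"
proof (induction h w rule: closes.induct)
  case (3 h w)
  show ?case
  proof (cases h)
    case 0
    then show ?thesis by (auto simp: prefixes_above_Cons endpoint_Cons simp del: take_Cons')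
  next
    case (Suc k)
    then show ?thesis using 3 prefixes_above_Cons[of w E "Suc k"] by (simp add: endpoint_Cons)
  qed
qed (simp_all add: prefixes_above_Cons endpoint_Cons)

lemma schroeder_paths_iff: "p \<in> schroeder_paths n \<longleftrightarrow> closes 0 p \<and> length (path_code 0 [] p) = n"
  by (auto simp: schroeder_paths_def closes_iff[of 0] length_code prod_eq_iff)

section \<open>Codes of Schroeder paths are the noncrossing sequences\<close>

lemma code_ups: "path_code x st (replicate k N @ w) = path_code x (replicate k x @ st) w"
  by (induction k arbitrary: st) (auto simp: replicate_app_Cons_same)

text \<open>An entry below the current column \<open>x\<close> can only come from an \<open>N\<close> step that is already on the
  stack, and each of these is closed exactly once.\<close>

lemma count_code_less:
  assumes "closes (length st) w" "y < x"
  shows "count_list (path_code x st w) y = count_list st y"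
  using assms
proof (induction x st w rule: path_code.induct)
  case (3 x st w)
  then show ?case by (cases st) auto
qed auto

lemma set_code_less:
  assumes "closes (length st) w" "y < x"
  shows "y \<in> set (path_code x st w) \<longleftrightarrow> y \<in> set st"
  using count_code_less[OF assms] by (metis count_list_0_iff)

text \<open>The entries equal to \<open>x\<close> count the \<open>N\<close> steps in column \<open>x\<close>, both those already taken and those
  still to come. This is how a path is recovered from its code.\<close>

lemma count_code_here:
  assumes "closes (length st) w"
  shows "count_list (path_code x st w) x = count_list st x + length (takeWhile (\<lambda>s. s = N) w)"
  using assms
proof (induction x st w rule: path_code.induct)
  case (3 x st w)
  then show ?case using count_code_less[of "tl st" w x "Suc x"] by (cases st) auto
next
  case (4 x st w)
  then show ?case using count_code_less[of "st" w x "Suc x"] by auto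
qed auto

lemma code_inject:
  assumes "closes (length st) v" "closes (length st) w" "path_code x st v = path_code x st w"
    "\<forall>a\<in>set st. a \<le> x"
  shows "v = w"
  using assms
proof (induction x st v arbitrary: w rule: path_code.induct)
  case (1 x st)
  show ?case
  proof (cases w)
    case (Cons s w')
    with 1 have "w = N # w'" by (cases s) auto
    then show ?thesis using 1 count_code_here[of "[]" w x] by simp
  qed simp
next
  case (2 x st v)
  have "length (takeWhile (\<lambda>s. s = N) w) = length (takeWhile (\<lambda>s. s = N) (N # v))"
    using count_code_here[OF "2.prems"(1), of x] count_code_here[OF "2.prems"(2), of x] "2.prems"(3)
      by simp
  then obtain w' where "w = N # w'"
    by (cases w) (auto split: if_splits)
  with 2 show ?case by auto
next
  case (3 x st v)
  have "length (takeWhile (\<lambda>s. s = N) w) = length (takeWhile (\<lambda>s. s = N) (E # v))"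
    using count_code_here[OF "3.prems"(1), of x] count_code_here[OF "3.prems"(2), of x] "3.prems"(3)
    by (simp del: path_code.simps)
  moreover have "hd st \<le> x" "st \<noteq> []" using 3 by (cases st; auto)+
  ultimately obtain w' where "w = E # w'"
    using "3.prems"(3) by (cases w; cases "hd w") (auto split: if_splits)
  with 3 \<open>st \<noteq> []\<close> show ?case by (cases st) (auto simp: le_SucI)
next
  case (4 x st v)
  have "length (takeWhile (\<lambda>s. s = N) w) = length (takeWhile (\<lambda>s. s = N) (D # v))"
    using count_code_here[OF "4.prems"(1), of x] count_code_here[OF "4.prems"(2), of x] "4.prems"(3)
    by (simp del: path_code.simps)
  moreover have "st \<noteq> [] \<Longrightarrow> hd st \<le> x" using 4 by (cases st; auto)
  ultimately obtain w' where "w = D # w'"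
    using "4.prems"(2,3) by (cases w; cases "hd w") (auto split: if_splits)
  with 4 show ?case by (auto simp: le_SucI)
qed

text \<open>In a list \<open>c\<^sub>x\<^sub>+\<^sub>1, c\<^sub>x\<^sub>+\<^sub>2, \<dots>\<close> the entry \<open>c\<^sub>b\<close> is at most \<open>b\<close>, and each later entry less than \<open>b\<close> is
  at most \<open>c\<^sub>b\<close>: an arc that begins before column \<open>b\<close> and ends after it encloses the arc ending
  there.\<close>

fun noncrossing :: "nat \<Rightarrow> nat list \<Rightarrow> bool" where
  "noncrossing x [] = True"
| "noncrossing x (a # cs) = (a \<le> x + 1 \<and> (\<forall>c\<in>set cs. c \<le> x \<longrightarrow> c \<le> a) \<and> noncrossing (x + 1) cs)"

lemma noncrossing_code:
  assumes "closes (length st) w" "sorted_wrt (\<ge>) (x # st)"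
  shows "noncrossing x (path_code x st w)"
  using assms
proof (induction x st w rule: path_code.induct)
  case (3 x st w)
  then show ?case using set_code_less[of "tl st" w _ "x + 1"] by (cases st) fastforce+
next
  case (4 x st w)
  then have "\<forall>a\<in>set st. a \<le> Suc x" by fastforce
  with 4 show ?case by auto
qed auto

text \<open>The path is forced: in column \<open>x\<close> take as many \<open>N\<close> steps as there are entries equal to \<open>x\<close>.
  The stack then holds all entries at most \<open>x\<close> that are still to come, and the noncrossing condition
  says that the next entry, if at most \<open>x\<close>, is the largest of them, that is, the top of the stack.\<close>

lemma ex_path_with_code:
  assumes "noncrossing x cs" "sorted_wrt (\<ge>) st" "\<forall>a\<in>set st. a < x"
    "mset st = filter_mset (\<lambda>a. a < x) (mset cs)"
  shows "\<exists>w. closes (length st) w \<and> path_code x st w = cs"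
  using assms
proof (induction cs arbitrary: x st)
  case Nil
  then show ?case by (intro exI[of _ "[]"]) simp
next
  case (Cons a cs)
  \<comment> \<open>The number of \<open>N\<close> steps to take in column \<open>x\<close>; none of them is on the stack yet.\<close>
  define k where "k = count_list (a # cs) x"
  define st' where "st' = replicate k x @ st"
  have closes_ups: "closes h (replicate j N @ w) = closes (j + h) w" for h j w
    by (induction j arbitrary: h) auto
  have desc_ups: "sorted_wrt (\<ge>) (replicate k x)"
    by (induction k) auto
  have mset': "mset st' = filter_mset (\<lambda>a. a < x + 1) (mset (a # cs))"
  proof (rule multiset_eqI)
    fix y
    show "count (mset st') y = count {#a \<in># mset (a # cs). a < x + 1#} y"
      using Cons.prems(4) by (cases y x rule: linorder_cases) (auto simp: st'_def k_def count_mset)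
  qed
  have sorted': "sorted_wrt (\<ge>) st'" "\<forall>c\<in>set st'. c < x + 1"
    using Cons.prems(2,3) desc_ups
    by (auto simp: st'_def sorted_wrt_append less_imp_le)
  show ?case
  proof (cases "a = x + 1")
    case True
    then have "\<exists>w. closes (length st') w \<and> path_code (x + 1) st' w = cs"
      using Cons.prems(1) sorted' mset' by (intro Cons.IH) auto
    then obtain w where "closes (length st') w" "path_code (x + 1) st' w = cs" by blast
    then show ?thesis using True
      by (intro exI[of _ "replicate k N @ D # w"]) (simp add: code_ups closes_ups st'_def)
  next
    case False
    then have a: "a \<le> x" using Cons.prems(1) by simp
    then have "a \<in># mset st'" unfolding mset' by simp
    then obtain b t where st': "st' = b # t" by (cases st') auto
    have "b \<in># mset (a # cs)" "b \<le> x"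
      using mset' st' by (metis (no_types, lifting) list.set_intros(1) mem_Collect_eq
        set_mset_filter set_mset_mset Suc_eq_plus1 less_Suc_eq_le)+
    then have "b \<le> a" using Cons.prems(1) by auto
    moreover have "a \<le> b" using \<open>a \<in># mset st'\<close> sorted'(1) st' by auto
    ultimately have "b = a" by simp
    then have "\<exists>w. closes (length t) w \<and> path_code (x + 1) t w = cs"
      using Cons.prems(1) sorted' mset' st' a by (intro Cons.IH) auto
    then obtain w where "closes (length t) w" "path_code (x + 1) t w = cs" by blast
    moreover have "k + length st = Suc (length t)"
      using arg_cong[OF st', of length] by (simp add: st'_def)
    ultimately show ?thesis using st' \<open>b = a\<close>
      by (intro exI[of _ "replicate k N @ E # w"]) (simp add: code_ups closes_ups flip: st'_def)
  qed
qed

section \<open>Labeled squares and matched steps\<close>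

text \<open>The condition on Schroeder paths that is inherited by prefixes, so that it can be used in an
  induction on the path from its start.\<close>

definition stays_above :: "path \<Rightarrow> bool" where
  "stays_above q \<longleftrightarrow> (\<forall>i\<le>length q. fst (endpoint (take i q)) \<le> snd (endpoint (take i q)))"

lemma stays_above_snoc:
  "stays_above (q @ [s]) \<longleftrightarrow> stays_above q \<and> fst (endpoint (q @ [s])) \<le> snd (endpoint (q @ [s]))"
  by (auto simp: stays_above_def le_Suc_eq)

lemma stays_above_appendD:
  assumes "stays_above (q @ w)"
  shows "stays_above q"
  unfolding stays_above_def
proof (intro allI impI)
  fix i assume "i \<le> length q"
  with assms[unfolded stays_above_def, rule_format, of i]
  show "fst (endpoint (take i q)) \<le> snd (endpoint (take i q))" by simp
qed

lemma has_step_at_append_left: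
  "has_step_at (q @ w) c P \<longleftrightarrow> has_step_at q c P \<or>
     (\<exists>i<length w. w ! i = c \<and> P = (fst (endpoint q) + fst (endpoint (take i w)), snd (endpoint q) +
       snd (endpoint (take i w))))"
proof -
  have split: "(\<exists>i<a + b. Q i) \<longleftrightarrow> (\<exists>i<a. Q i) \<or> (\<exists>i<b. Q (a + i))" for Q and a b :: nat
  proof
    assume "\<exists>i<a + b. Q i"
    then obtain i where i: "i < a + b" "Q i" by blast
    show "(\<exists>i<a. Q i) \<or> (\<exists>i<b. Q (a + i))"
    proof (cases "i < a")
      case False
      then have "i - a < b" "Q (a + (i - a))" using i by auto
      then show ?thesis by blast
    qed (use i in blast)
  next
    assume "(\<exists>i<a. Q i) \<or> (\<exists>i<b. Q (a + i))"
    then show "\<exists>i<a + b. Q i" by (meson nat_add_left_cancel_less trans_less_add1)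
  qed
  show ?thesis
    unfolding has_step_at_def length_append split[of "length q" "length w"]
    by (simp add: nth_append endpoint_append conj_commute eq_commute[of P] cong: conj_cong)
qed

lemma has_step_at_snoc:
  "has_step_at (q @ [s]) c P \<longleftrightarrow> has_step_at q c P \<or> (c = s \<and> P = endpoint q)"
  by (auto simp: has_step_at_append_left)

lemma on_or_below_snoc:
  "on_or_below P (q @ [s]) \<longleftrightarrow> on_or_below P q \<or>
     (fst (endpoint (q @ [s])) = fst P \<and> snd P \<le> snd (endpoint (q @ [s])))"
proof -
  have split: "(\<exists>i\<le>Suc a. Q i) \<longleftrightarrow> (\<exists>i\<le>a. Q i) \<or> Q (Suc a)" for Q and a :: nat
    by (metis le_Suc_eq order_refl)
  have "length (q @ [s]) = Suc (length q)" by simp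
  then show ?thesis
    unfolding on_or_below_def by (simp only: split) (simp cong: conj_cong)
qed

text \<open>The squares on the diagonal strip at level \<open>k\<close> between an \<open>N\<close> step and its matching \<open>E\<close> step.\<close>

definition arc_squares :: "nat \<times> nat \<times> nat \<Rightarrow> (nat \<times> nat) set" where
  "arc_squares = (\<lambda>(a, b, k). {(r, r + k) | r. a < r \<and> r \<le> b})"

definition closed_squares :: "path \<Rightarrow> (nat \<times> nat) set" where
  "closed_squares q = \<Union> (arc_squares ` set (arcs 0 [] q))"

text \<open>The squares of the strips that begin at an unmatched \<open>N\<close> step and reach up to the current
  column.\<close>

definition open_squares :: "path \<Rightarrow> (nat \<times> nat) set" where
  "open_squares q = {(r, r + k) | r k. k < length (stack_after 0 [] q) \<and>
      rev (stack_after 0 [] q) ! k < r \<and> r \<le> fst (endpoint q) + 1}"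

definition latest_N :: "path \<Rightarrow> nat \<Rightarrow> nat \<Rightarrow> bool" where
  "latest_N q k a \<longleftrightarrow> has_step_at q N (a, a + k) \<and> (\<forall>x>a. \<not> has_step_at q N (x, x + k))"

lemma snd_endpoint_eq:
  "stays_above q \<Longrightarrow> snd (endpoint q) = fst (endpoint q) + length (stack_after 0 [] q)"
proof (induction q rule: rev_induct)
  case (snoc s q)
  then show ?case 
    by (cases s) (auto simp: stays_above_snoc stack_after_append endpoint_append endpoint_Cons)
qed simp

lemma in_set_tl: "a \<in> set (tl xs) \<Longrightarrow> a \<in> set xs"
  by (cases xs) auto

lemma stack_le: "stays_above q \<Longrightarrow> a \<in> set (stack_after 0 [] q) \<Longrightarrow> a \<le> fst (endpoint q)"
proof (induction q rule: rev_induct)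
  case (snoc s q)
  then show ?case 
    by (cases s) (auto simp: stays_above_snoc stack_after_append endpoint_append endpoint_Cons
      length_code
        le_SucI dest: in_set_tl)
qed simp

text \<open>A path gets below height \<open>k + 1\<close> only by an \<open>E\<close> step that removes the stack entry at level
  \<open>k\<close>. Therefore the entry at level \<open>k\<close> records the last upward crossing of that level. To the right
  of it lies the square at which the walk in the definition of \<open>sigmas\<close> stops.\<close>

lemma stack_latest_N:
  assumes "stays_above q" "k < length (stack_after 0 [] q)"
  shows "latest_N q k (rev (stack_after 0 [] q) ! k)"
  using assms
proof (induction q arbitrary: k rule: rev_induct)
  case (snoc s q)
  then have q: "stays_above q" by (simp add: stays_above_snoc)
  note len = snd_endpoint_eq[OF q]
  let ?st = "stack_after 0 [] q"
  show ?case
  proof (cases s)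
    case E
    then have "?st \<noteq> []"
      using snoc.prems(1) len by (auto simp: stays_above_snoc endpoint_append endpoint_Cons)
    then have "rev (tl ?st) ! k = rev ?st ! k" "k < length ?st"
      using snoc.prems(2) E by (cases ?st; auto simp: stack_after_append nth_append)+
    with snoc.IH[OF q, of k] show ?thesis
      by (auto simp: latest_N_def has_step_at_snoc stack_after_append E)
  next
    case N
    have st: "stack_after 0 [] (q @ [N]) = fst (endpoint q) # ?st"
      by (simp add: stack_after_append length_code)
    show ?thesis
    proof (cases "k < length ?st")
      case True
      then show ?thesis using snoc.IH[OF q True] len
        by (auto simp: latest_N_def has_step_at_snoc st nth_append prod_eq_iff N)
    next
      case False
      then have k: "k = length ?st" using snoc.prems(2) st N by simp
      have "\<not> has_step_at q N (x, x + k)" if "x > fst (endpoint q)" for x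
      proof
        assume "has_step_at q N (x, x + k)"
        then obtain i where "i < length q" "endpoint (take i q) = (x, x + k)"
          by (auto simp: has_step_at_def)
        moreover have "fst (endpoint (take i q)) \<le> fst (endpoint q)"
          using endpoint_append[of "take i q" "drop i q"] by simp
        ultimately show False using that by simp
      qed
      then show ?thesis using len k
        by (auto simp: latest_N_def has_step_at_snoc st nth_append prod_eq_iff N)
    qed
  next
    case D
    with snoc q show ?thesis
      by (auto simp: latest_N_def has_step_at_snoc stack_after_append)
  qed
qed simp

lemma arc_le: "stays_above q \<Longrightarrow> (a, b, k) \<in> set (arcs 0 [] q) \<Longrightarrow> b \<le> fst (endpoint q)"
proof (induction q rule: rev_induct)
  case (snoc s q)
  then show ?case
    by (cases s) (auto simp: stays_above_snoc arcs_append endpoint_append endpoint_Cons length_code)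
qed simp

lemma closed_squares_le: "stays_above q \<Longrightarrow> (r, s) \<in> closed_squares q \<Longrightarrow> r \<le> fst (endpoint q)"
  using arc_le by (fastforce simp: closed_squares_def arc_squares_def)

lemma finite_closed_squares: "finite (closed_squares q)"
proof -
  have "arc_squares (a, b, k) \<subseteq> (\<lambda>r. (r, r + k)) ` {..b}" for a b k
    by (auto simp: arc_squares_def)
  then have "finite (arc_squares x)" for x
    by (cases x) (metis finite_atMost finite_imageI finite_subset)
  then show ?thesis by (auto simp: closed_squares_def)
qed

lemma labeled_squares_snoc:
  "labeled_squares (q @ [s]) = labeled_squares q \<union>
     {(r, t). r = fst (endpoint (q @ [s])) + 1 \<and> r \<le> t \<and> t \<le> snd (endpoint (q @ [s]))}"
  by (auto simp: labeled_squares_def on_or_below_snoc)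

lemma closed_squares_snoc:
  "closed_squares (q @ [N]) = closed_squares q"
  "closed_squares (q @ [D]) = closed_squares q"
  "closed_squares (q @ [E]) = closed_squares q \<union> arc_squares
     (hd (stack_after 0 [] q), fst (endpoint q) + 1, length (stack_after 0 [] q) - 1)"
  by (auto simp: closed_squares_def arcs_append length_code)

lemma mem_open_squares:
  "(r, t) \<in> open_squares q \<longleftrightarrow> r \<le> t \<and> t - r < length (stack_after 0 [] q) \<and>
     rev (stack_after 0 [] q) ! (t - r) < r \<and> r \<le> fst (endpoint q) + 1" (is "?l \<longleftrightarrow> ?r")
proof
  assume ?r
  then have "\<exists>k. t = r + k \<and> k < length (stack_after 0 [] q) \<and> rev (stack_after 0 [] q) ! k < r"
    by (intro exI[of _ "t - r"]) simp
  with \<open>?r\<close> show ?l unfolding open_squares_def by blast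
qed (auto simp: open_squares_def)

lemma stack_nth_le:
  "stays_above q \<Longrightarrow> k < length (stack_after 0 [] q) \<Longrightarrow> rev (stack_after 0 [] q) ! k \<le> fst (endpoint q)"
  using stack_le[of q "rev (stack_after 0 [] q) ! k"] by (metis length_rev nth_mem set_rev)

text \<open>Induction along the path. An \<open>N\<close> step opens a new strip, an \<open>E\<close> step closes the topmost one,
  and an \<open>E\<close> or \<open>D\<close> step extends the strips that stay open by one square each.\<close>

lemma squares_decompose:
  assumes "stays_above q"
  shows "labeled_squares q = closed_squares q \<union> open_squares q \<and> closed_squares q \<inter> open_squares q = {}"
  using assms
proof (induction q rule: rev_induct)
  case Nil
  then show ?case
    by (auto simp: labeled_squares_def on_or_below_def closed_squares_def open_squares_def)
next
  case (snoc s q)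
  then have q: "stays_above q" by (simp add: stays_above_snoc)
  let ?st = "stack_after 0 [] q" and ?x = "fst (endpoint q)"
  note len = snd_endpoint_eq[OF q] and IH = snoc.IH[OF q]
  note le = stack_nth_le[OF q] and closed_le = closed_squares_le[OF q]
  have labeled: "(r, t) \<in> labeled_squares q \<longleftrightarrow> (r, t) \<in> closed_squares q \<or> (r, t) \<in> open_squares q"
    and disjoint: "\<not> ((r, t) \<in> closed_squares q \<and> (r, t) \<in> open_squares q)" for r t
    using IH by auto
  have "((r, t) \<in> labeled_squares (q @ [s]) \<longleftrightarrow>
          (r, t) \<in> closed_squares (q @ [s]) \<or> (r, t) \<in> open_squares (q @ [s])) \<and>
        \<not> ((r, t) \<in> closed_squares (q @ [s]) \<and> (r, t) \<in> open_squares (q @ [s]))" for r t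
  proof -
    have far: "r \<noteq> ?x + 1 \<and> r \<noteq> ?x + 2" if "(r, t) \<in> closed_squares q"
      using closed_le[OF that] by simp
    show ?thesis
    proof (cases s)
      case N
      have "(r, t) \<in> open_squares (q @ [s]) \<longleftrightarrow> (r, t) \<in> open_squares q \<or> (r = ?x + 1 \<and> t = r + length
        ?st)"
        by (auto simp: mem_open_squares N stack_after_append length_code endpoint_append
          endpoint_Cons nth_append less_Suc_eq)
      moreover have "(r, t) \<in> labeled_squares (q @ [s]) \<longleftrightarrow>
          (r, t) \<in> labeled_squares q \<or> (r, t) \<in> open_squares q \<or> (r = ?x + 1 \<and> t = r + length ?st)"
      proof (cases "r = ?x + 1")
        case True
        have "?x + 1 \<le> t \<and> t \<le> ?x + length ?st + 1 \<longleftrightarrow>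
            (?x + 1 \<le> t \<and> t - (?x + 1) < length ?st) \<or> t = ?x + 1 + length ?st"
          by linarith
        moreover have "(r, t) \<in> open_squares q \<longleftrightarrow> ?x + 1 \<le> t \<and> t - (?x + 1) < length ?st"
          using True le[of "t - r"] by (auto simp: mem_open_squares)
        moreover have "(r, t) \<in> labeled_squares (q @ [s]) \<longleftrightarrow>
            (r, t) \<in> labeled_squares q \<or> (?x + 1 \<le> t \<and> t \<le> ?x + length ?st + 1)"
          using True len by (simp add: labeled_squares_snoc N endpoint_append endpoint_Cons)
        ultimately show ?thesis using True by simp
      qed (use labeled[of r t] in \<open>auto simp: labeled_squares_snoc N endpoint_append endpoint_Cons\<close>)
      ultimately show ?thesis using labeled[of r t] disjoint[of r t] far closed_squares_snoc(1)[of q]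
        unfolding N by blast
    next
      case D
      have "(r, t) \<in> open_squares (q @ [s]) \<longleftrightarrow>
          (r, t) \<in> open_squares q \<or> (r = ?x + 2 \<and> r \<le> t \<and> t - r < length ?st)"
        using le[of "t - r"]
        by (auto simp: mem_open_squares D stack_after_append length_code endpoint_append endpoint_Cons)
      moreover have "(r, t) \<in> labeled_squares (q @ [s]) \<longleftrightarrow>
          (r, t) \<in> labeled_squares q \<or> (r = ?x + 2 \<and> r \<le> t \<and> t - r < length ?st)"
        using len by (auto simp: labeled_squares_snoc D endpoint_append endpoint_Cons)
      ultimately show ?thesis using labeled[of r t] disjoint[of r t] far closed_squares_snoc(2)[of q]
        unfolding D by blast
    next
      case E
      then have "?st \<noteq> []"
        using snoc.prems(1) len by (auto simp: stays_above_snoc endpoint_append endpoint_Cons)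
      then obtain a st' where st: "?st = a # st'" by (cases ?st) auto
      have arc: "(r, t) \<in> arc_squares (a, ?x + 1, length st') \<longleftrightarrow>
          (r, t) \<in> open_squares q \<and> t = r + length st'"
        by (auto simp: arc_squares_def mem_open_squares st nth_append)
      have "(r, t) \<in> open_squares (q @ [s]) \<longleftrightarrow>
          (r, t) \<in> open_squares q \<and> t \<noteq> r + length st' \<or> (r = ?x + 2 \<and> r \<le> t \<and> t - r < length st')"
        using le[of "t - r"]
        by (auto simp: mem_open_squares E stack_after_append length_code endpoint_append
          endpoint_Cons st nth_append)
      moreover have "(r, t) \<in> labeled_squares (q @ [s]) \<longleftrightarrow>
          (r, t) \<in> labeled_squares q \<or> (r = ?x + 2 \<and> r \<le> t \<and> t - r < length st')"
        using len st by (auto simp: labeled_squares_snoc E endpoint_append endpoint_Cons)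
      moreover have "(r, t) \<in> closed_squares (q @ [s]) \<longleftrightarrow>
          (r, t) \<in> closed_squares q \<or> (r, t) \<in> open_squares q \<and> t = r + length st'"
        using arc by (simp add: closed_squares_snoc E st)
      moreover have "r \<noteq> ?x + 2" if "(r, t) \<in> open_squares q"
        using that by (simp add: mem_open_squares)
      ultimately show ?thesis using labeled[of r t] disjoint[of r t] far by blast
    qed
  qed
  then show ?case by auto
qed

text \<open>The labeled square with the largest label belongs to the last \<open>E\<close> step, and the walk from it
  to the lower left runs through exactly the strip of this step. Removing the strip leaves the
  closed squares of a shorter prefix, to which the induction hypothesis applies with a longer
  remainder \<open>w\<close>.\<close>

lemma sigmas_closed_squares:
  assumes "stays_above (q @ w)"
  shows "sigmas (q @ w) (closed_squares q) = rev (map (\<lambda>(a, b, k). rev [a + 1..<b + 1]) (arcs 0 [] q))"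
  using assms
proof (induction q arbitrary: w rule: rev_induct)
  case Nil
  then show ?case by (subst sigmas.simps) (simp add: closed_squares_def)
next
  case (snoc s q)
  from snoc.prems have q': "stays_above (q @ [s])" by (rule stays_above_appendD)
  then have q: "stays_above q" by (simp add: stays_above_snoc)
  have IH: "sigmas (q @ s # w) (closed_squares q) = rev (map (\<lambda>(a, b, k). rev [a + 1..<b + 1]) (arcs
    0 [] q))"
    using snoc.IH[of "s # w"] snoc.prems by simp
  let ?st = "stack_after 0 [] q" and ?x = "fst (endpoint q)"
  show ?case
  proof (cases s)
    case E
    then have "?st \<noteq> []"
      using q' snd_endpoint_eq[OF q] by (auto simp: stays_above_snoc endpoint_append endpoint_Cons)
    then obtain a st' where st: "?st = a # st'" by (cases ?st) auto
    define k where "k = length st'"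
    have ax: "a \<le> ?x" using stack_le[OF q, of a] st by simp
    let ?T = "arc_squares (a, ?x + 1, k)"
    let ?L = "closed_squares q \<union> ?T"
    have L: "closed_squares (q @ [s]) = ?L"
      by (simp add: E closed_squares_snoc st k_def)
    have "?T \<subseteq> open_squares q"
      by (auto simp: arc_squares_def mem_open_squares st nth_append k_def)
    then have disj: "closed_squares q \<inter> ?T = {}" using squares_decompose[OF q] by blast
    have fin: "finite ?L" using finite_closed_squares[of "q @ [s]"] L by simp
    have top: "(?x + 1, ?x + 1 + k) \<in> ?T" using ax by (auto simp: arc_squares_def)
    have max: "Max (fst ` ?L) = ?x + 1"
    proof (rule Max_eqI)
      show "finite (fst ` ?L)" using fin by simp
      show "?x + 1 \<in> fst ` ?L" using top by force
      show "r \<le> ?x + 1" if "r \<in> fst ` ?L" for r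
        using that closed_squares_le[OF q] by (fastforce simp: arc_squares_def)
    qed
    \<comment> \<open>Strips of earlier \<open>E\<close> steps do not reach column \<open>?x + 1\<close>, so the choice of \<open>s\<close> is unique.\<close>
    have col: "{t. (?x + 1, t) \<in> ?L} = {?x + 1 + k}"
      using closed_squares_le[OF q] ax by (fastforce simp: arc_squares_def)
    have latest: "latest_N q k a"
      using stack_latest_N[OF q, of k] st by (simp add: k_def nth_append)
    \<comment> \<open>Apart from \<open>s\<close>, which is not an \<open>N\<close> step, all steps of \<open>s # w\<close> start to the right of \<open>?x\<close>.\<close>
    have left_N: "left_side_N (q @ s # w) (?x + 1 - j, ?x + 1 + k - j) \<longleftrightarrow> has_step_at q N (?x - j, ?x
      + k - j)"
      if "j \<le> ?x" for j
    proof -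
      have "\<not> (i < length (s # w) \<and> (s # w) ! i = N \<and> ?x - j = ?x + fst (endpoint (take i (s #
        w))))" for i
        using E by (cases i) (auto simp: endpoint_Cons)
      then show ?thesis
        unfolding left_side_N_def has_step_at_append_left by (auto simp: Suc_diff_le that)
    qed
    have least: "(LEAST j. left_side_N (q @ s # w) (?x + 1 - j, ?x + 1 + k - j)) = ?x - a"
    proof (rule Least_equality)
      show "left_side_N (q @ s # w) (?x + 1 - (?x - a), ?x + 1 + k - (?x - a))"
        using latest ax left_N[of "?x - a"] by (simp add: latest_N_def add.commute)
      show "?x - a \<le> j" if "left_side_N (q @ s # w) (?x + 1 - j, ?x + 1 + k - j)" for j
      proof (rule ccontr)
        assume j: "\<not> ?x - a \<le> j"
        then have eq: "?x + k - j = ?x - j + k" by simp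
        have "j \<le> ?x" using j by simp
        from that[unfolded left_N[OF this] eq] have "has_step_at q N (?x - j, ?x - j + k)" .
        moreover have "a < ?x - j" using j by linarith
        ultimately show False using latest by (auto simp: latest_N_def)
      qed
    qed
    have T: "{(?x + 1 - i, ?x + 1 + k - i) | i. i \<le> ?x - a} = ?T"
    proof (intro set_eqI iffI)
      fix P assume "P \<in> ?T"
      then obtain r where "P = (r, r + k)" "a < r" "r \<le> ?x + 1" by (auto simp: arc_squares_def)
      then show "P \<in> {(?x + 1 - i, ?x + 1 + k - i) | i. i \<le> ?x - a}"
        by (auto intro!: exI[of _ "?x + 1 - r"])
    qed (use ax in \<open>auto simp: arc_squares_def\<close>)
    have nonempty: "finite ?L \<and> ?L \<noteq> {}" using fin top by blast
    have "sigmas (q @ s # w) ?L = rev [?x + 1 - (?x - a)..<?x + 1 + 1] # sigmas (q @ s # w) (?L - ?T)"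
      unfolding sigmas.simps[of "q @ s # w" ?L] if_P[OF nonempty] Let_def max col Max_singleton
        least T ..
    moreover have "?L - ?T = closed_squares q" using disj by blast
    moreover have "?x + 1 - (?x - a) = a + 1" using ax by simp
    ultimately have "sigmas (q @ s # w) ?L = rev [a + 1..<?x + 1 + 1] # sigmas (q @ s # w)
      (closed_squares q)"
      by simp
    then show ?thesis
      using IH L unfolding E by (simp add: arcs_append length_code st k_def del: upt_Suc)
  qed (use IH in \<open>simp_all add: closed_squares_snoc arcs_append\<close>)
qed

section \<open>Lehmer codes\<close>

fun lehmer_from :: "'a::linorder list \<Rightarrow> 'a list \<Rightarrow> nat list" where
  "lehmer_from pre [] = []"
| "lehmer_from pre (x # xs) = length (filter (\<lambda>y. x < y) pre) # lehmer_from (pre @ [x]) xs"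

abbreviation lehmer :: "'a::linorder list \<Rightarrow> nat list" where
  "lehmer \<equiv> lehmer_from []"

lemma lehmer_from_append: "lehmer_from pre (xs @ ys) = lehmer_from pre xs @ lehmer_from (pre @ xs) ys"
  by (induction pre xs rule: lehmer_from.induct) auto

lemma length_lehmer_from [simp]: "length (lehmer_from pre xs) = length xs"
  by (induction pre xs rule: lehmer_from.induct) auto

lemma nth_lehmer_from:
  "j < length xs \<Longrightarrow> lehmer_from pre xs ! j = length (filter (\<lambda>y. xs ! j < y) (pre @ take j xs))"
proof (induction pre xs arbitrary: j rule: lehmer_from.induct)
  case (2 pre x xs)
  then show ?case by (cases j) auto
qed simp

text \<open>Only the relative order of the entries matters.\<close>

lemma lehmer_cong:
  fixes xs :: "'a::linorder list" and ys :: "'b::linorder list"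
  assumes "length xs = length ys"
    "\<And>i j. i < length xs \<Longrightarrow> j < length xs \<Longrightarrow> xs ! i < xs ! j \<longleftrightarrow> ys ! i < ys ! j"
  shows "lehmer xs = lehmer ys"
proof (rule nth_equalityI)
  fix j assume "j < length (lehmer xs)"
  then have j: "j < length xs" by simp
  have "{i. i < length (take j xs) \<and> xs ! j < take j xs ! i} = {i. i < length (take j ys) \<and> ys ! j <
    take j ys ! i}"
    using assms j by auto
  then show "lehmer xs ! j = lehmer ys ! j"
    using j assms(1) by (simp add: nth_lehmer_from length_filter_conv_card)
qed (use assms in simp)

text \<open>The entries larger than a given value form an upper set in the order of the earlier entries.
  Upper sets of a linear order are nested, so the size of this one determines it. Hence by induction
  the relative order of two words with the same Lehmer code is the same.\<close>

lemma lehmer_eq_imp_same_order: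
  fixes xs :: "'a::linorder list" and ys :: "'b::linorder list"
  assumes "lehmer xs = lehmer ys" "distinct xs" "distinct ys" "i < length xs" "j < length xs"
  shows "xs ! i < xs ! j \<longleftrightarrow> ys ! i < ys ! j"
  using assms
proof (induction xs arbitrary: ys i j rule: rev_induct)
  case (snoc x xs zs)
  have "length zs = Suc (length xs)"
    using arg_cong[OF snoc.prems(1), of length] by simp
  then obtain y ys where zs: "zs = ys @ [y]" by (cases zs rule: rev_cases) auto
  with \<open>length zs = Suc (length xs)\<close> have len: "length ys = length xs" by simp
  have eq: "lehmer xs = lehmer ys" "length (filter (\<lambda>z. x < z) xs) = length (filter (\<lambda>z. y < z) ys)"
    using snoc.prems(1) len by (auto simp: zs lehmer_from_append)
  have order: "xs ! i < xs ! j \<longleftrightarrow> ys ! i < ys ! j" if "i < length xs" "j < length xs" for i j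
    using snoc.IH[OF eq(1)] snoc.prems that by (auto simp: zs)
  define U where "U = {i. i < length xs \<and> x < xs ! i}"
  define V where "V = {i. i < length xs \<and> y < ys ! i}"
  have card: "card U = card V" and fin: "finite U" "finite V"
    using eq(2) len by (auto simp: U_def V_def length_filter_conv_card)
  \<comment> \<open>Both are upper sets with respect to the common order of the first entries.\<close>
  have "U \<subseteq> V \<or> V \<subseteq> U"
  proof (rule ccontr)
    assume "\<not> (U \<subseteq> V \<or> V \<subseteq> U)"
    then obtain i j where "i \<in> U" "i \<notin> V" "j \<in> V" "j \<notin> U" by blast
    then show False using order[of j i] by (auto simp: U_def V_def)
  qed
  then have "U = V" using card fin by (metis card_subset_eq)
  then have UV: "x < xs ! i \<longleftrightarrow> y < ys ! i" if "i < length xs" for i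
    using that by (auto simp: U_def V_def)
  moreover have "xs ! i < x \<longleftrightarrow> ys ! i < y" if "i < length xs" for i
  proof -
    have "xs ! i \<noteq> x" "ys ! i \<noteq> y"
      using snoc.prems(2,3) that len by (auto simp: zs)
    then show ?thesis using UV[OF that] by (meson linorder_less_linear order_less_asym)
  qed
  ultimately show ?case
    using snoc.prems(4,5) order len by (auto simp: zs nth_append less_Suc_eq)
qed simp

text \<open>A permutation of \<open>{1..m}\<close> can be read off from the relative order of its entries.\<close>

lemma permutes_eq_card:
  assumes "\<sigma> permutes {1..m}" "i \<in> {1..m}"
  shows "card {j \<in> {1..m}. \<sigma> j \<le> \<sigma> i} = \<sigma> i"
proof -
  have "\<sigma> ` {j \<in> {1..m}. \<sigma> j \<le> \<sigma> i} = {1..\<sigma> i}"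
  proof (intro set_eqI iffI)
    fix v assume v: "v \<in> {1..\<sigma> i}"
    have "\<sigma> i \<le> m" using assms permutes_in_image by fastforce
    then have "v \<in> \<sigma> ` {1..m}" using v permutes_image[OF assms(1)] by auto
    then show "v \<in> \<sigma> ` {j \<in> {1..m}. \<sigma> j \<le> \<sigma> i}" using v by auto
  next
    fix v assume "v \<in> \<sigma> ` {j \<in> {1..m}. \<sigma> j \<le> \<sigma> i}"
    then show "v \<in> {1..\<sigma> i}" using permutes_in_image[OF assms(1)] by fastforce
  qed
  moreover have "inj_on \<sigma> {j \<in> {1..m}. \<sigma> j \<le> \<sigma> i}"
    using permutes_inj_on[OF assms(1)] .
  ultimately show ?thesis using card_image by fastforce
qed

definition one_line :: "nat \<Rightarrow> (nat \<Rightarrow> nat) \<Rightarrow> nat list" where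
  "one_line m \<sigma> = map \<sigma> [1..<m + 1]"

lemma length_one_line [simp]: "length (one_line m \<sigma>) = m"
  by (simp add: one_line_def del: upt_Suc)

lemma nth_one_line: "i < m \<Longrightarrow> one_line m \<sigma> ! i = \<sigma> (i + 1)"
  by (simp add: one_line_def del: upt_Suc)

lemma distinct_one_line: "\<sigma> permutes {1..m} \<Longrightarrow> distinct (one_line m \<sigma>)"
  by (simp add: one_line_def distinct_map permutes_inj_on del: upt_Suc)

lemma lehmer_determines_perm:
  assumes \<sigma>: "\<sigma> permutes {1..m}" and \<tau>: "\<tau> permutes {1..m}"
    and eq: "lehmer (one_line m \<sigma>) = lehmer (one_line m \<tau>)"
  shows "\<sigma> = \<tau>"
proof
  fix i
  have order: "\<sigma> i < \<sigma> j \<longleftrightarrow> \<tau> i < \<tau> j" if "i \<in> {1..m}" "j \<in> {1..m}" for i j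
    using lehmer_eq_imp_same_order[OF eq distinct_one_line[OF \<sigma>] distinct_one_line[OF \<tau>], of "i - 1"
      "j - 1"] that
    by (auto simp: nth_one_line Suc_le_eq)
  show "\<sigma> i = \<tau> i"
  proof (cases "i \<in> {1..m}")
    case True
    have "{j \<in> {1..m}. \<sigma> j \<le> \<sigma> i} = {j \<in> {1..m}. \<tau> j \<le> \<tau> i}"
      using order[OF True] by (auto simp: not_less[symmetric])
    then show ?thesis using permutes_eq_card[OF \<sigma> True] permutes_eq_card[OF \<tau> True] by simp
  qed (use \<sigma> \<tau> in \<open>simp add: permutes_not_in\<close>)
qed

section \<open>The Lehmer code of phi\<close>

text \<open>The indices of the adjacent transpositions in \<open>\<sigma>\<^sub>k \<dots> \<sigma>\<^sub>1\<close>: the factors appear here in the order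
  of the path, since \<open>\<sigma>\<^sub>1\<close> belongs to the last \<open>E\<close> step.\<close>

definition sigma_indices :: "path \<Rightarrow> nat list" where
  "sigma_indices q = concat (map (\<lambda>(a, b, k). rev [a + 1..<b + 1]) (arcs 0 [] q))"

lemma schroeder_path_stays_above: "p \<in> schroeder_paths n \<Longrightarrow> stays_above p"
  by (simp add: schroeder_paths_def stays_above_def)

lemma phi_eq_act_sigma_indices:
  assumes "p \<in> schroeder_paths n"
  shows "phi n p = act (sigma_indices p) (decreasing_perm (n + 1))"
proof -
  have p: "stays_above p" using assms by (rule schroeder_path_stays_above)
  have "endpoint p = (n, n)" using assms by (simp add: schroeder_paths_def)
  then have "stack_after 0 [] p = []" using snd_endpoint_eq[OF p] by simp
  then have "labeled_squares p = closed_squares p"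
    using squares_decompose[OF p] by (simp add: open_squares_def)
  then show ?thesis
    using sigmas_closed_squares[of p "[]"] p by (simp add: phi_def sigma_indices_def)
qed

lemma act_append: "act (u @ v) \<pi> = act u (act v \<pi>)"
  by (simp add: act_def)

text \<open>The product \<open>s\<^sub>b \<dots> s\<^sub>a\<^sub>+\<^sub>1\<close> moves the entry at position \<open>a + 1\<close> to position \<open>b + 1\<close>.\<close>

lemma act_rev_upt:
  assumes "a \<le> b"
  shows "act (rev [a + 1..<b + 1]) \<pi> i =
    (if i = b + 1 then \<pi> (a + 1) else if a < i \<and> i \<le> b then \<pi> (i + 1) else \<pi> i)"
  using assms
proof (induction b arbitrary: i rule: dec_induct)
  case base
  then show ?case by (simp add: act_def)
next
  case (step b)
  have "act (rev [a + 1..<Suc b + 1]) \<pi> i = act (rev [a + 1..<b + 1]) \<pi> (Transposition.transpose (b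
    + 1) (b + 2) i)"
    using step.hyps by (simp add: act_def adj_swap_def)
  then show ?case unfolding step.IH
    using step.hyps by (auto simp: Transposition.transpose_def)
qed

lemma upt_split: "i \<le> j \<Longrightarrow> j \<le> k \<Longrightarrow> [i..<k] = [i..<j] @ [j..<k]"
  using upt_add_eq_append[of i j "k - j"] by simp

text \<open>The factor of the last step of the path acts first, on a decreasing word. It moves the entry
  with exactly \<open>a\<close> larger ones to the last position, and what precedes is decreasing again, so that
  the induction hypothesis applies to it. The values before the last position are only permuted
  afterwards, so the number of larger ones among them stays \<open>a\<close>.\<close>

lemma lehmer_act_sigma_indices:
  assumes "stays_above q" "\<And>i j. 1 \<le> i \<Longrightarrow> i < j \<Longrightarrow> j \<le> fst (endpoint q) + 1 \<Longrightarrow> \<pi> j < \<pi> i"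
  shows "(\<forall>i>fst (endpoint q) + 1. act (sigma_indices q) \<pi> i = \<pi> i) \<and>
    mset (map (act (sigma_indices q) \<pi>) [1..<fst (endpoint q) + 2]) = mset (map \<pi> [1..<fst (endpoint
      q) + 2]) \<and>
    lehmer (map (act (sigma_indices q) \<pi>) [1..<fst (endpoint q) + 2]) = 0 # path_code 0 [] q"
  using assms
proof (induction q arbitrary: \<pi> rule: rev_induct)
  case Nil
  then show ?case by (simp add: sigma_indices_def act_def)
next
  case (snoc s q)
  then have q: "stays_above q" by (simp add: stays_above_snoc)
  let ?x = "fst (endpoint q)"
  have upt: "[1..<?x + 3] = [1..<?x + 2] @ [?x + 2]"
    using upt_Suc_append[of 1 "?x + 2"] by (simp add: eval_nat_numeral del: upt_Suc)
  show ?case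
  proof (cases s)
    case N
    then show ?thesis using snoc.IH[OF q, of \<pi>] snoc.prems(2)
      by (simp add: sigma_indices_def arcs_append code_append endpoint_append endpoint_Cons del:
        upt_Suc)
  next
    case D
    let ?\<rho> = "act (sigma_indices q) \<pi>"
    have fixed: "\<forall>i>?x + 1. ?\<rho> i = \<pi> i"
      and m: "mset (map ?\<rho> [1..<?x + 2]) = mset (map \<pi> [1..<?x + 2])"
      and l: "lehmer (map ?\<rho> [1..<?x + 2]) = 0 # path_code 0 [] q"
      using snoc.IH[OF q, of \<pi>] snoc.prems(2) by (auto simp: D endpoint_append endpoint_Cons)
    have "length (filter (\<lambda>y. \<pi> (?x + 2) < y) (map ?\<rho> [1..<?x + 2])) =
        size (filter_mset (\<lambda>y. \<pi> (?x + 2) < y) (mset (map ?\<rho> [1..<?x + 2])))"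
      by (metis mset_filter size_mset)
    also have "\<dots> = length (filter (\<lambda>y. \<pi> (?x + 2) < y) (map \<pi> [1..<?x + 2]))"
      unfolding m by (metis mset_filter size_mset)
    also have "filter (\<lambda>y. \<pi> (?x + 2) < y) (map \<pi> [1..<?x + 2]) = map \<pi> [1..<?x + 2]"
      using snoc.prems(2) by (auto simp: filter_id_conv D endpoint_append endpoint_Cons)
    finally have "length (filter (\<lambda>y. \<pi> (?x + 2) < y) (map ?\<rho> [1..<?x + 2])) = ?x + 1" by simp
    moreover have "sigma_indices (q @ [s]) = sigma_indices q" "fst (endpoint (q @ [s])) = ?x + 1"
      "path_code 0 [] (q @ [s]) = path_code 0 [] q @ [?x + 1]"
      by (simp_all add: D sigma_indices_def arcs_append endpoint_append endpoint_Cons code_append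
        length_code)
    moreover have "[1..<?x + 1 + 2] = [1..<?x + 2] @ [?x + 2]" using upt by (simp add:
      eval_nat_numeral del: upt_Suc)
    moreover have "?\<rho> (?x + 2) = \<pi> (?x + 2)" using fixed by simp
    ultimately show ?thesis using fixed m l
      by (simp only: map_append mset_append list.map lehmer_from_append) simp
  next
    case E
    let ?st = "stack_after 0 [] q"
    have "?st \<noteq> []"
      using snoc.prems(1) snd_endpoint_eq[OF q] by (auto simp: E stays_above_snoc endpoint_append
        endpoint_Cons)
    then obtain a st' where st: "?st = a # st'" by (cases ?st) auto
    have ax: "a \<le> ?x" using stack_le[OF q, of a] st by simp
    have dec: "\<pi> j < \<pi> i" if "1 \<le> i" "i < j" "j \<le> ?x + 2" for i j
      using snoc.prems(2) that by (simp add: E endpoint_append endpoint_Cons)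
    \<comment> \<open>The word after the first factor: the entry at position \<open>a + 1\<close> has gone to the end.\<close>
    define \<tau> where "\<tau> = act (rev [a + 1..<?x + 1 + 1]) \<pi>"
    have \<tau>: "\<tau> i = (if i = ?x + 2 then \<pi> (a + 1) else if a < i \<and> i \<le> ?x + 1 then \<pi> (i + 1) else \<pi>
      i)" for i
      unfolding \<tau>_def using act_rev_upt[of a "?x + 1" \<pi> i] ax by simp
    let ?\<rho> = "act (sigma_indices q) \<tau>"
    have "\<tau> j < \<tau> i" if "1 \<le> i" "i < j" "j \<le> ?x + 1" for i j
      using that by (auto simp: \<tau> intro!: dec)
    then have fixed: "\<forall>i>?x + 1. ?\<rho> i = \<tau> i"
      and m: "mset (map ?\<rho> [1..<?x + 2]) = mset (map \<tau> [1..<?x + 2])"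
      and l: "lehmer (map ?\<rho> [1..<?x + 2]) = 0 # path_code 0 [] q"
      using snoc.IH[OF q, of \<tau>] by auto
    have split: "[1..<?x + 2] = [1..<a + 1] @ [a + 1..<?x + 2]"
      using ax by (intro upt_split) simp_all
    have "map \<tau> [a + 1..<?x + 2] = map \<pi> [a + 2..<?x + 3]"
    proof -
      have "map Suc [a + 1..<?x + 2] = [a + 2..<?x + 3]"
        unfolding map_Suc_upt by (simp add: eval_nat_numeral del: upt_Suc)
      then have "map \<pi> [a + 2..<?x + 3] = map (\<pi> \<circ> Suc) [a + 1..<?x + 2]"
        by (metis map_map)
      then show ?thesis by (auto simp: \<tau> simp del: upt_Suc)
    qed
    moreover have "map \<tau> [1..<a + 1] = map \<pi> [1..<a + 1]"
      using ax by (auto simp: \<tau>)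
    ultimately have map\<tau>: "map \<tau> [1..<?x + 2] = map \<pi> [1..<a + 1] @ map \<pi> [a + 2..<?x + 3]"
      unfolding split by simp
    have "length (filter (\<lambda>y. \<pi> (a + 1) < y) (map ?\<rho> [1..<?x + 2])) =
        size (filter_mset (\<lambda>y. \<pi> (a + 1) < y) (mset (map ?\<rho> [1..<?x + 2])))"
      by (metis mset_filter size_mset)
    also have "\<dots> = length (filter (\<lambda>y. \<pi> (a + 1) < y) (map \<tau> [1..<?x + 2]))"
      unfolding m by (metis mset_filter size_mset)
    also have "filter (\<lambda>y. \<pi> (a + 1) < y) (map \<tau> [1..<?x + 2]) = map \<pi> [1..<a + 1]"
    proof -
      have "filter (\<lambda>y. \<pi> (a + 1) < y) (map \<pi> [1..<a + 1]) = map \<pi> [1..<a + 1]"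
        using ax by (auto simp: filter_id_conv intro!: dec)
      moreover have "filter (\<lambda>y. \<pi> (a + 1) < y) (map \<pi> [a + 2..<?x + 3]) = []"
      proof -
        have "\<not> \<pi> (a + 1) < \<pi> j" if "j \<in> {a + 2..<?x + 3}" for j
          using that dec[of "a + 1" j] by auto
        then show ?thesis by (auto simp: filter_empty_conv simp del: upt_Suc)
      qed
      ultimately show ?thesis unfolding map\<tau> by simp
    qed
    finally have c: "length (filter (\<lambda>y. \<pi> (a + 1) < y) (map ?\<rho> [1..<?x + 2])) = a" by simp
    have "[1..<?x + 3] = [1..<a + 1] @ (a + 1) # [a + 2..<?x + 3]"
      using ax upt_split[of 1 "a + 1" "?x + 3"] upt_conv_Cons[of "a + 1" "?x + 3"]
      by (simp del: upt_Suc)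
    then have m': "mset (map \<pi> [1..<?x + 3]) = add_mset (\<pi> (a + 1)) (mset (map \<tau> [1..<?x + 2]))"
      unfolding map\<tau> by simp
    have "sigma_indices (q @ [s]) = sigma_indices q @ rev [a + 1..<?x + 1 + 1]"
      by (simp add: E sigma_indices_def arcs_append length_code st)
    then have \<rho>: "act (sigma_indices (q @ [s])) \<pi> = ?\<rho>"
      by (simp only: act_append \<tau>_def)
    have *: "fst (endpoint (q @ [s])) = ?x + 1" "path_code 0 [] (q @ [s]) = path_code 0 [] q @ [a]"
      by (simp_all add: E endpoint_append endpoint_Cons code_append length_code st)
    have **: "[1..<?x + 1 + 2] = [1..<?x + 2] @ [?x + 2]" using upt by (simp add: eval_nat_numeral
      del: upt_Suc)
    have last: "?\<rho> (?x + 2) = \<pi> (a + 1)" using fixed by (simp add: \<tau>)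
    have "?\<rho> i = \<pi> i" if "i > ?x + 2" for i using fixed that by (simp add: \<tau>)
    moreover have "mset (map ?\<rho> [1..<?x + 1 + 2]) = mset (map \<pi> [1..<?x + 1 + 2])"
    proof -
      have "mset (map ?\<rho> [1..<?x + 1 + 2]) = add_mset (\<pi> (a + 1)) (mset (map ?\<rho> [1..<?x + 2]))"
        unfolding ** using last by (simp del: upt_Suc)
      also have "\<dots> = mset (map \<pi> [1..<?x + 3])" unfolding m m' ..
      finally show ?thesis by (simp add: eval_nat_numeral del: upt_Suc)
    qed
    moreover have "lehmer (map ?\<rho> [1..<?x + 1 + 2]) = 0 # path_code 0 [] q @ [a]"
      using l c last unfolding ** by (simp add: lehmer_from_append del: upt_Suc)
    ultimately show ?thesis unfolding \<rho> * by simp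
  qed
qed

lemma phi_permutes_and_lehmer:
  assumes "p \<in> schroeder_paths n"
  shows "phi n p permutes {1..n + 1}" "lehmer (one_line (n + 1) (phi n p)) = 0 # path_code 0 [] p"
proof -
  have p: "stays_above p" using assms by (rule schroeder_path_stays_above)
  have end_p: "endpoint p = (n, n)" using assms by (simp add: schroeder_paths_def)
  let ?dec = "decreasing_perm (n + 1)"
  have dec: "?dec j < ?dec i" if "1 \<le> i" "i < j" "j \<le> fst (endpoint p) + 1" for i j
    using that by (simp add: decreasing_perm_def end_p)
  note * = lehmer_act_sigma_indices[OF p, of ?dec, OF dec, unfolded end_p fst_conv]
  have eq: "phi n p = act (sigma_indices p) ?dec" by (rule phi_eq_act_sigma_indices[OF assms])
  show "lehmer (one_line (n + 1) (phi n p)) = 0 # path_code 0 [] p"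
    using * unfolding eq one_line_def by (simp add: eval_nat_numeral del: upt_Suc)
  have m: "mset (map (phi n p) [1..<n + 2]) = mset (map ?dec [1..<n + 2])"
    using * unfolding eq by blast
  have img: "phi n p ` {1..n + 1} = ?dec ` {1..n + 1}"
    using arg_cong[OF m, of set_mset] by (simp add: atLeastLessThanSuc_atLeastAtMost del: upt_Suc)
  also have "?dec ` {1..n + 1} = {1..n + 1}"
  proof (intro set_eqI iffI)
    fix i assume "i \<in> {1..n + 1}"
    then show "i \<in> ?dec ` {1..n + 1}"
      by (intro image_eqI[of _ _ "n + 2 - i"]) (auto simp: decreasing_perm_def)
  qed (auto simp: decreasing_perm_def)
  finally have img: "phi n p ` {1..n + 1} = {1..n + 1}" .
  then have "inj_on (phi n p) {1..n + 1}"
    by (intro eq_card_imp_inj_on) simp_all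
  with img have "bij_betw (phi n p) {1..n + 1} {1..n + 1}" by (simp add: bij_betw_def)
  moreover have "phi n p i = i" if "i \<notin> {1..n + 1}" for i
  proof (cases i)
    case 0
    have "act ks \<pi> 0 = \<pi> 0" if "0 \<notin> set ks" for ks \<pi>
      using that by (induction ks) (auto simp: act_def adj_swap_def Transposition.transpose_def)
    moreover have "0 \<notin> set (sigma_indices p)" by (auto simp: sigma_indices_def)
    ultimately show ?thesis unfolding eq 0 by (simp add: decreasing_perm_def)
  next
    case (Suc j)
    then show ?thesis using * that unfolding eq by (simp add: decreasing_perm_def)
  qed
  ultimately show "phi n p permutes {1..n + 1}" by (rule bij_imp_permutes)
qed

section \<open>Pattern avoidance in terms of Lehmer codes\<close>

text \<open>Replaces the embedding in the definition of pattern containment by four explicit positions.\<close>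

lemma contains_pattern_4:
  "contains_pattern m \<pi> [a, b, c, d] \<longleftrightarrow> (\<exists>i j k l. 1 \<le> i \<and> i < j \<and> j < k \<and> k < l \<and> l \<le> m \<and>
     (\<forall>s<4. \<forall>t<4. \<pi> ([i, j, k, l] ! s) < \<pi> ([i, j, k, l] ! t) \<longleftrightarrow> [a, b, c, d] ! s < [a, b, c, d] ! t))"
  (is "?l \<longleftrightarrow> ?r")
proof -
  have length4: "length [a, b, c, d] = 4" by simp
  show ?thesis
  proof
    assume ?l
    then obtain f where f: "strict_mono_on {..<4} f" "f ` {..<4} \<subseteq> {1..m}"
      "\<forall>s<4. \<forall>t<4. \<pi> (f s) < \<pi> (f t) \<longleftrightarrow> [a, b, c, d] ! s < [a, b, c, d] ! t"
      unfolding contains_pattern_def length4 by blast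
    have nth: "[f 0, f 1, f 2, f 3] ! s = f s" if "s < 4" for s
      using that by (auto simp: less_Suc_eq eval_nat_numeral)
    have "f 0 < f 1" "f 1 < f 2" "f 2 < f 3"
      using f(1) by (auto simp: strict_mono_on_def)
    moreover have "1 \<le> f 0" "f 3 \<le> m" using f(2) by (auto simp: image_subset_iff)
    ultimately show ?r using f(3) nth
      by (intro exI[of _ "f 0"] exI[of _ "f 1"] exI[of _ "f 2"] exI[of _ "f 3"]) simp
  next
    assume ?r
    then obtain i j k l where *: "1 \<le> i" "i < j" "j < k" "k < l" "l \<le> m"
      "\<forall>s<4. \<forall>t<4. \<pi> ([i, j, k, l] ! s) < \<pi> ([i, j, k, l] ! t) \<longleftrightarrow> [a, b, c, d] ! s < [a, b, c, d] ! t"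
      by blast
    have "sorted_wrt (<) [i, j, k, l]" using * by simp
    then have "strict_mono_on {..<4} ((!) [i, j, k, l])"
      using sorted_wrt_nth_less[of "(<)" "[i, j, k, l]"] by (simp add: strict_mono_on_def)
    moreover have "(!) [i, j, k, l] ` {..<4} \<subseteq> {1..m}"
    proof
      fix v assume "v \<in> (!) [i, j, k, l] ` {..<4}"
      then obtain s where "s < 4" "v = [i, j, k, l] ! s" by blast
      then have "v \<in> set [i, j, k, l]" using nth_mem[of s "[i, j, k, l]"] by simp
      then show "v \<in> {1..m}" using * by auto
    qed
    ultimately show ?l using *(6)
      unfolding contains_pattern_def length4 by blast
  qed
qed

text \<open>The two patterns differ only in the order of their first two entries, so together they impose
  no condition on that order.\<close>

definition contains_1243_or_2143 :: "nat \<Rightarrow> (nat \<Rightarrow> nat) \<Rightarrow> bool" where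
  "contains_1243_or_2143 m \<pi> \<longleftrightarrow> (\<exists>i j k l. 1 \<le> i \<and> i < j \<and> j < k \<and> k < l \<and> l \<le> m \<and>
     \<pi> i < \<pi> l \<and> \<pi> j < \<pi> l \<and> \<pi> l < \<pi> k)"

lemma schroeder_perms_iff: "\<pi> \<in> schroeder_perms m \<longleftrightarrow> \<pi> permutes {1..m} \<and> \<not> contains_1243_or_2143 m \<pi>"
proof -
  have all4: "(\<forall>s<4. P s) \<longleftrightarrow> P 0 \<and> P (Suc 0) \<and> P (Suc (Suc 0)) \<and> P (Suc (Suc (Suc 0)))" for P :: "nat
    \<Rightarrow> bool"
    by (auto simp: less_Suc_eq eval_nat_numeral)
  have "contains_pattern m \<pi> [1,2,4,3] \<or> contains_pattern m \<pi> [2,1,4,3] \<longleftrightarrow> contains_1243_or_2143 m \<pi>"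
    if "inj \<pi>"
  proof
    assume "contains_pattern m \<pi> [1,2,4,3] \<or> contains_pattern m \<pi> [2,1,4,3]"
    then show "contains_1243_or_2143 m \<pi>" unfolding contains_pattern_4 all4 contains_1243_or_2143_def
      by (elim disjE) (simp, blast)+
  next
    assume "contains_1243_or_2143 m \<pi>"
    then obtain i j k l where *: "1 \<le> i" "i < j" "j < k" "k < l" "l \<le> m"
       "\<pi> i < \<pi> l" "\<pi> j < \<pi> l" "\<pi> l < \<pi> k"
      by (auto simp: contains_1243_or_2143_def)
    have "\<pi> i \<noteq> \<pi> j" using that *(2) by (metis inj_eq less_irrefl)
    then consider "\<pi> i < \<pi> j" | "\<pi> j < \<pi> i" by linarith
    then show "contains_pattern m \<pi> [1,2,4,3] \<or> contains_pattern m \<pi> [2,1,4,3]"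
    proof cases
      case 1
      then have "contains_pattern m \<pi> [1,2,4,3]" unfolding contains_pattern_4 all4 using *
        by (intro exI[of _ i] exI[of _ j] exI[of _ k] exI[of _ l]) simp
      then show ?thesis ..
    next
      case 2
      then have "contains_pattern m \<pi> [2,1,4,3]" unfolding contains_pattern_4 all4 using *
        by (intro exI[of _ i] exI[of _ j] exI[of _ k] exI[of _ l]) simp
      then show ?thesis ..
    qed
  qed
  then show ?thesis using permutes_inj by (auto simp: schroeder_perms_def)
qed

definition inversions :: "(nat \<Rightarrow> nat) \<Rightarrow> nat \<Rightarrow> nat" where
  "inversions \<pi> j = card {i \<in> {1..<j}. \<pi> j < \<pi> i}"

lemma nth_lehmer_one_line:
  assumes "k < m"
  shows "lehmer (one_line m \<pi>) ! k = inversions \<pi> (k + 1)"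
proof -
  have "{i. i < k \<and> \<pi> (k + 1) < take k (one_line m \<pi>) ! i} = {i. i < k \<and> \<pi> (k + 1) < \<pi> (i + 1)}"
    using assms by (auto simp: nth_one_line simp del: upt_Suc)
  moreover have "bij_betw Suc {i. i < k \<and> \<pi> (k + 1) < \<pi> (i + 1)} {i \<in> {1..<k + 1}. \<pi> (k + 1) < \<pi> i}"
    by (rule bij_betw_byWitness[of _ "\<lambda>i. i - 1"]) auto
  then have "card {i. i < k \<and> \<pi> (k + 1) < \<pi> (i + 1)} = inversions \<pi> (k + 1)"
    unfolding inversions_def by (rule bij_betw_same_card)
  ultimately show ?thesis using assms
    by (simp add: nth_lehmer_from length_filter_conv_card nth_one_line)
qed

lemma inversions_le: "inversions \<pi> j \<le> j - 1"
proof -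
  have "inversions \<pi> j \<le> card {1..<j}" unfolding inversions_def by (intro card_mono) auto
  then show ?thesis by simp
qed

text \<open>For one direction take an occurrence of the pattern in which the positions \<open>j < k\<close> of the last
  two entries are as close as possible. Then all entries between are smaller than \<open>\<pi> k\<close>, so the
  larger entries before \<open>k\<close> are \<open>\<pi> j\<close> and some of the entries before \<open>j\<close>, with at least two
  exceptions. For the other direction, some entry \<open>\<pi> l\<close> with \<open>j \<le> l < k\<close> exceeds \<open>\<pi> k\<close>, because \<open>k\<close>
  has more inversions than \<open>j\<close>. So fewer than \<open>inversions \<pi> k\<close> of the \<open>j - 1\<close> entries before \<open>j\<close>
  exceed \<open>\<pi> k\<close>, which leaves at least two smaller ones.\<close>

lemma contains_1243_or_2143_iff_inversions:
  assumes "inj \<pi>"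
  shows "contains_1243_or_2143 m \<pi> \<longleftrightarrow> (\<exists>j k. 1 \<le> j \<and> j < k \<and> k \<le> m \<and> inversions \<pi> j < inversions \<pi> k
    \<and> inversions \<pi> k + 1 < j)"
proof
  assume "contains_1243_or_2143 m \<pi>"
  \<comment> \<open>\<open>B d\<close>: the pattern occurs with its last two entries at distance \<open>d\<close>.\<close>
  define B where "B d \<longleftrightarrow> (\<exists>j k. j < k \<and> k \<le> m \<and> k = j + d \<and> \<pi> k < \<pi> j \<and>
     (\<exists>i i'. 1 \<le> i \<and> i < i' \<and> i' < j \<and> \<pi> i < \<pi> k \<and> \<pi> i' < \<pi> k))" for d
  have B_I: "B (k - j)" if "j < k" "k \<le> m" "\<pi> k < \<pi> j" "1 \<le> i" "i < i'" "i' < j" "\<pi> i < \<pi> k" "\<pi> i' <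
    \<pi> k" for i i' j k
  proof -
    have "k = j + (k - j)" using that(1) by simp
    then show ?thesis unfolding B_def using that by blast
  qed
  obtain i i' j k where "j < k" "k \<le> m" "\<pi> k < \<pi> j" "1 \<le> i" "i < i'" "i' < j" "\<pi> i < \<pi> k" "\<pi> i' < \<pi> k"
    using \<open>contains_1243_or_2143 m \<pi>\<close> unfolding contains_1243_or_2143_def by blast
  then have "B (k - j)" by (rule B_I)
  then have "\<exists>d. B d" ..
  define d where "d = (LEAST d. B d)"
  have "B d" unfolding d_def using \<open>\<exists>d. B d\<close> by (rule LeastI_ex)
  have min: "\<not> B d'" if "d' < d" for d' using that unfolding d_def by (rule not_less_Least)
  from \<open>B d\<close> obtain j k i i' where *: "j < k" "k \<le> m" "k = j + d" "\<pi> k < \<pi> j"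
     "1 \<le> i" "i < i'" "i' < j" "\<pi> i < \<pi> k" "\<pi> i' < \<pi> k" unfolding B_def by blast
  have between: "\<pi> l < \<pi> k" if "j < l" "l < k" for l
  proof (rule ccontr)
    assume "\<not> \<pi> l < \<pi> k"
    then have "\<pi> k < \<pi> l" using assms that(2) by (metis inj_eq less_irrefl linorder_less_linear)
    then have "B (k - l)"
      using * that by (intro B_I[of l k i i']) auto
    moreover have "k - l < d" using * that by simp
    ultimately show False using min by blast
  qed
  have eq: "{l \<in> {1..<k}. \<pi> k < \<pi> l} = insert j {l \<in> {1..<j}. \<pi> k < \<pi> l}"
  proof (intro set_eqI iffI)
    fix l assume "l \<in> {l \<in> {1..<k}. \<pi> k < \<pi> l}"
    then show "l \<in> insert j {l \<in> {1..<j}. \<pi> k < \<pi> l}" using between[of l] by (cases l j rule: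
      linorder_cases) auto
  qed (use * in auto)
  have inv_k: "inversions \<pi> k = Suc (card {l \<in> {1..<j}. \<pi> k < \<pi> l})"
    unfolding inversions_def eq by simp
  have "inversions \<pi> j \<le> card {l \<in> {1..<j}. \<pi> k < \<pi> l}"
    unfolding inversions_def using * by (intro card_mono) auto
  moreover have "card {l \<in> {1..<j}. \<pi> k < \<pi> l} \<le> card ({1..<j} - {i, i'})"
    using * by (intro card_mono) auto
  moreover have "card ({1..<j} - {i, i'}) = j - 1 - 2"
    using * by (subst card_Diff_subset) auto
  moreover have "j \<ge> 3" using * by linarith
  ultimately show "\<exists>j k. 1 \<le> j \<and> j < k \<and> k \<le> m \<and> inversions \<pi> j < inversions \<pi> k \<and> inversions \<pi> k +
    1 < j"
    using * inv_k by (intro exI[of _ j] exI[of _ k] conjI) linarith+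
next
  assume "\<exists>j k. 1 \<le> j \<and> j < k \<and> k \<le> m \<and> inversions \<pi> j < inversions \<pi> k \<and> inversions \<pi> k + 1 < j"
  then obtain j k where jk: "1 \<le> j" "j < k" "k \<le> m" "inversions \<pi> j < inversions \<pi> k" "inversions \<pi>
    k + 1 < j"
    by blast
  have "\<exists>l. j \<le> l \<and> l < k \<and> \<pi> k < \<pi> l"
  proof (rule ccontr)
    assume none: "\<not> (\<exists>l. j \<le> l \<and> l < k \<and> \<pi> k < \<pi> l)"
    then have "\<pi> j \<le> \<pi> k" using jk by (meson leI order_refl)
    then have "inversions \<pi> k \<le> inversions \<pi> j"
      unfolding inversions_def using none by (intro card_mono) auto
    then show False using jk by simp
  qed
  then obtain l where l: "j \<le> l" "l < k" "\<pi> k < \<pi> l" by blast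
  \<comment> \<open>The entries before position \<open>j\<close> that can serve as the first two of the pattern.\<close>
  define S where "S = {i \<in> {1..<j}. \<pi> i < \<pi> k}"
  have "{1..<j} = S \<union> {i \<in> {1..<j}. \<pi> k < \<pi> i}"
  proof -
    have "i \<in> S \<or> \<pi> k < \<pi> i" if "i \<in> {1..<j}" for i
      using that jk(2) assms inj_eq[of \<pi> i k] by (auto simp: S_def not_less le_less)
    then show ?thesis unfolding S_def by blast
  qed
  then have "card {1..<j} \<le> card S + card {i \<in> {1..<j}. \<pi> k < \<pi> i}"
    by (metis card_Un_le)
  moreover have "card (insert l {i \<in> {1..<j}. \<pi> k < \<pi> i}) \<le> inversions \<pi> k"
    unfolding inversions_def using l jk by (intro card_mono) auto
  moreover have "card (insert l {i \<in> {1..<j}. \<pi> k < \<pi> i}) = Suc (card {i \<in> {1..<j}. \<pi> k < \<pi> i})"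
    using l by simp
  ultimately have "2 \<le> card S" using jk by simp
  moreover have "finite S" by (simp add: S_def)
  ultimately obtain i i' where "i \<in> S" "i' \<in> S" "i \<noteq> i'"
    using card_le_Suc0_iff_eq[of S] by auto
  then obtain i i' where "i \<in> S" "i' \<in> S" "i < i'" by (cases "i < i'") (auto simp: not_less le_less)
  then show "contains_1243_or_2143 m \<pi>" unfolding contains_1243_or_2143_def S_def using l jk
    by (intro exI[of _ i] exI[of _ i'] exI[of _ l] exI[of _ k]) auto
qed

lemma noncrossing_iff_nth:
  "noncrossing x cs \<longleftrightarrow> (\<forall>i<length cs. cs ! i \<le> x + i + 1 \<and>
     (\<forall>j<length cs. i < j \<longrightarrow> cs ! j \<le> x + i \<longrightarrow> cs ! j \<le> cs ! i))"
proof (induction x cs rule: noncrossing.induct)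
  case (2 x a cs)
  then show ?case
    by (simp add: All_less_Suc2 all_set_conv_all_nth)
qed simp

text \<open>Entry \<open>i\<close> of \<open>cs\<close> belongs to position \<open>i + 2\<close>: lists are indexed from \<open>0\<close>, positions from \<open>1\<close>,
  and the first position has the code entry \<open>0\<close> that is split off.\<close>

lemma schroeder_perms_iff_noncrossing:
  assumes "\<pi> permutes {1..n + 1}" "lehmer (one_line (n + 1) \<pi>) = 0 # cs"
  shows "\<pi> \<in> schroeder_perms (n + 1) \<longleftrightarrow> noncrossing 0 cs"
proof -
  have len: "length cs = n" using arg_cong[OF assms(2), of length] by simp
  have cs: "cs ! i = inversions \<pi> (i + 2)" if "i < n" for i
    using nth_lehmer_one_line[of "i + 1" "n + 1" \<pi>] that unfolding assms(2) by simp
  have "\<forall>i<n. cs ! i \<le> i + 1" 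
  proof (intro allI impI)
    fix i assume "i < n"
    then show "cs ! i \<le> i + 1" using cs[of i] inversions_le[of \<pi> "i + 2"] by simp
  qed
  then have "noncrossing 0 cs \<longleftrightarrow> (\<forall>i<n. \<forall>j<n. i < j \<longrightarrow> cs ! j \<le> i \<longrightarrow> cs ! j \<le> cs ! i)"
    by (simp add: noncrossing_iff_nth len)
  also have "\<dots> \<longleftrightarrow> \<not> (\<exists>i<n. \<exists>j<n. i < j \<and> inversions \<pi> (j + 2) \<le> i \<and> inversions \<pi> (i + 2) < inversions
    \<pi> (j + 2))"
    by (simp add: cs cong: conj_cong imp_cong) (meson not_le)
  also have "\<dots> \<longleftrightarrow> \<not> contains_1243_or_2143 (n + 1) \<pi>"
  proof -
    have "(\<exists>i<n. \<exists>j<n. i < j \<and> inversions \<pi> (j + 2) \<le> i \<and> inversions \<pi> (i + 2) < inversions \<pi> (j +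
      2)) \<longleftrightarrow> contains_1243_or_2143 (n + 1) \<pi>"
      (is "?l \<longleftrightarrow> _")
      unfolding contains_1243_or_2143_iff_inversions[OF permutes_inj[OF assms(1)]]
    proof
      assume ?l
      then obtain i j where "i < n" "j < n" "i < j" "inversions \<pi> (j + 2) \<le> i" "inversions \<pi> (i + 2)
        < inversions \<pi> (j + 2)"
        by blast
      then show "\<exists>j k. 1 \<le> j \<and> j < k \<and> k \<le> n + 1 \<and> inversions \<pi> j < inversions \<pi> k \<and> inversions \<pi> k
        + 1 < j"
        by (intro exI[of _ "i + 2"] exI[of _ "j + 2"]) simp
    next
      assume "\<exists>j k. 1 \<le> j \<and> j < k \<and> k \<le> n + 1 \<and> inversions \<pi> j < inversions \<pi> k \<and> inversions \<pi> k + 1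
        < j"
      then obtain j k where "1 \<le> j" "j < k" "k \<le> n + 1" "inversions \<pi> j < inversions \<pi> k"
        "inversions \<pi> k + 1 < j"
        by blast
      moreover from this have "j = (j - 2) + 2" "k = (k - 2) + 2" by simp_all
      ultimately show ?l
        by (intro exI[of _ "j - 2"] conjI exI[of _ "k - 2"]) (simp_all)
    qed
    then show ?thesis by blast
  qed
  finally show ?thesis using assms(1) by (simp add: schroeder_perms_iff)
qed

lemma phi_in_schroeder_perms:
  assumes "p \<in> schroeder_paths n"
  shows "phi n p \<in> schroeder_perms (n + 1)"
proof -
  have "noncrossing 0 (path_code 0 [] p)"
    using noncrossing_code[of "[]" p 0] assms by (simp add: schroeder_paths_iff)
  then show ?thesis
    using schroeder_perms_iff_noncrossing[OF phi_permutes_and_lehmer[OF assms]] by simp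
qed

lemma inj_on_phi: "inj_on (phi n) (schroeder_paths n)"
proof (rule inj_onI)
  fix p q assume p: "p \<in> schroeder_paths n" and q: "q \<in> schroeder_paths n" and "phi n p = phi n q"
  then have "path_code 0 [] p = path_code 0 [] q"
    using phi_permutes_and_lehmer(2)[OF p] phi_permutes_and_lehmer(2)[OF q] by simp
  then show "p = q" using p q code_inject[of "[]" p q 0] by (simp add: schroeder_paths_iff)
qed

lemma ex_path_with_phi:
  assumes "\<pi> \<in> schroeder_perms (n + 1)"
  shows "\<exists>p\<in>schroeder_paths n. phi n p = \<pi>"
proof -
  have perm: "\<pi> permutes {1..n + 1}" using assms by (simp add: schroeder_perms_iff)
  obtain cs where cs: "lehmer (one_line (n + 1) \<pi>) = 0 # cs"
    by (simp add: one_line_def upt_conv_Cons del: upt_Suc)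
  have "noncrossing 0 cs" using schroeder_perms_iff_noncrossing[OF perm cs] assms by simp
  then obtain p where p: "closes 0 p" "path_code 0 [] p = cs"
    using ex_path_with_code[of 0 cs "[]"] by auto
  have "length cs = n" using arg_cong[OF cs, of length] by simp
  then have "p \<in> schroeder_paths n" using p by (simp add: schroeder_paths_iff)
  moreover from this have "phi n p = \<pi>"
    using lehmer_determines_perm[OF phi_permutes_and_lehmer(1) perm] phi_permutes_and_lehmer(2) cs
      p(2) by simp
  ultimately show ?thesis by blast
qed

section \<open>The pattern 2134 and reverse-complements\<close>

lemma rc_permutes:
  assumes "\<sigma> permutes {1..m}"
  shows "rc m \<sigma> permutes {1..m}"
proof (rule bij_imp_permutes)
  have inner: "bij_betw (\<lambda>i. m + 1 - i) {1..m} {1..m}"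
    by (rule bij_betw_byWitness[of _ "\<lambda>i. m + 1 - i"]) auto
  have "bij_betw ((\<lambda>i. m + 1 - i) \<circ> \<sigma> \<circ> (\<lambda>i. m + 1 - i)) {1..m} {1..m}"
    using inner permutes_imp_bij[OF assms] by (intro bij_betw_trans)
  then show "bij_betw (rc m \<sigma>) {1..m} {1..m}"
    by (rule bij_betw_cong[THEN iffD1, rotated]) (auto simp: rc_def)
qed (auto simp: rc_def)

text \<open>If \<open>l\<close> has no more inversions than \<open>k\<close>, then \<open>\<pi> k < \<pi> l\<close>. If \<open>j\<close> has more than \<open>k\<close>, then some
  entry before \<open>j\<close> that exceeds \<open>\<pi> j\<close> does not exceed \<open>\<pi> k\<close>.\<close>

lemma ex_2134_if_inversions:
  assumes "inj \<pi>" "1 \<le> j" "j < k" "k < l" "inversions \<pi> l \<le> inversions \<pi> k" "inversions \<pi> k <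
    inversions \<pi> j"
  shows "\<exists>i. 1 \<le> i \<and> i < j \<and> \<pi> j < \<pi> i \<and> \<pi> i < \<pi> k \<and> \<pi> k < \<pi> l"
proof -
  have "\<pi> k < \<pi> l"
  proof (rule ccontr)
    assume "\<not> \<pi> k < \<pi> l"
    then have "\<pi> l < \<pi> k" using assms(1,4) by (metis inj_eq less_irrefl linorder_less_linear)
    then have "card (insert k {i \<in> {1..<k}. \<pi> k < \<pi> i}) \<le> inversions \<pi> l"
      unfolding inversions_def using assms by (intro card_mono) auto
    then show False using assms(5) by (simp add: inversions_def)
  qed
  moreover have "\<not> {i \<in> {1..<j}. \<pi> j < \<pi> i} \<subseteq> {i \<in> {1..<k}. \<pi> k < \<pi> i}"
  proof
    assume "{i \<in> {1..<j}. \<pi> j < \<pi> i} \<subseteq> {i \<in> {1..<k}. \<pi> k < \<pi> i}"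
    then have "inversions \<pi> j \<le> inversions \<pi> k" unfolding inversions_def by (intro card_mono) auto
    then show False using assms(6) by simp
  qed
  then obtain i where "1 \<le> i" "i < j" "\<pi> j < \<pi> i" "\<not> \<pi> k < \<pi> i" using assms(3) by auto
  moreover from this have "\<pi> i < \<pi> k"
    using assms(1,3) by (metis inj_eq less_irrefl linorder_less_linear order_less_trans)
  ultimately show ?thesis by blast
qed

lemma rc_contains_if_2134:
  assumes "\<pi> permutes {1..m}" "1 \<le> i" "i < j" "j < k" "k < l" "l \<le> m" "\<pi> j < \<pi> i" "\<pi> i < \<pi> k" "\<pi> k <
    \<pi> l"
  shows "contains_1243_or_2143 m (rc m \<pi>)"
proof -
  have "\<pi> l \<le> m" using permutes_in_image[OF assms(1), of l] assms by simp
  have reflect: "rc m \<pi> (m + 1 - t) = m + 1 - \<pi> t" if "1 \<le> t" "t \<le> m" for t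
  proof -
    have "m + 1 - t \<in> {1..m}" "m + 1 - (m + 1 - t) = t" using that by auto
    then show ?thesis by (simp only: rc_def if_True)
  qed
  have "1 \<le> m + 1 - l" "m + 1 - l < m + 1 - k" "m + 1 - k < m + 1 - j" "m + 1 - j < m + 1 - i" "m +
    1 - i \<le> m"
    using assms by linarith+
  moreover have "m + 1 - \<pi> l < m + 1 - \<pi> i" "m + 1 - \<pi> k < m + 1 - \<pi> i" "m + 1 - \<pi> i < m + 1 - \<pi> j"
    using assms \<open>\<pi> l \<le> m\<close> by linarith+
  moreover have "i \<le> m" "1 \<le> j" "j \<le> m" "1 \<le> k" "k \<le> m" "1 \<le> l" using assms by linarith+
  ultimately show ?thesis unfolding contains_1243_or_2143_def using assms(2,6)
    by (intro exI[of _ "m + 1 - l"] exI[of _ "m + 1 - k"] exI[of _ "m + 1 - j"] exI[of _ "m + 1 - i"])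
       (simp only: reflect)
qed

text \<open>In the code of a path, a subsequence \<open>d\<close>, \<open>a\<close>, \<open>b\<close> with \<open>b \<le> a < d\<close> means that two nested
  arcs, from \<open>a\<close> and from \<open>b\<close>, cover either a \<open>D\<close> step or an arc that starts strictly to the right
  of both.\<close>

definition shallow :: "nat list \<Rightarrow> bool" where
  "shallow cs \<longleftrightarrow> (\<forall>d a b. subseq [d, a, b] cs \<longrightarrow> a < d \<longrightarrow> a < b)"

lemma subseq_three_nth:
  assumes "subseq [d, a, b] cs"
  shows "\<exists>i j k. i < j \<and> j < k \<and> k < length cs \<and> cs ! i = d \<and> cs ! j = a \<and> cs ! k = b"
proof -
  obtain us vs where 1: "cs = us @ d # vs" "subseq [a, b] vs" using list_emb_ConsD[OF assms] by auto
  obtain us' vs' where 2: "vs = us' @ a # vs'" "subseq [b] vs'" using list_emb_ConsD[OF 1(2)] by auto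
  obtain us'' vs'' where 3: "vs' = us'' @ b # vs''" using list_emb_ConsD[OF 2(2)] by auto
  show ?thesis
    by (intro exI[of _ "length us"] exI[of _ "length us + 1 + length us'"] exI[of _ "length us + 1 +
      length us' + 1 + length us''"])
       (simp add: 1 2 3 nth_append)
qed

lemma rc_avoids_imp_shallow:
  assumes "\<pi> permutes {1..n + 1}" "lehmer (one_line (n + 1) \<pi>) = 0 # cs" "rc (n + 1) \<pi> \<in>
    schroeder_perms (n + 1)"
  shows "shallow cs"
  unfolding shallow_def
proof (intro allI impI, rule ccontr)
  fix d a b assume "subseq [d, a, b] cs" "a < d" "\<not> a < b"
  then obtain i j k where *: "i < j" "j < k" "k < length cs" "cs ! j < cs ! i" "cs ! k \<le> cs ! j"
    using subseq_three_nth by (metis linorder_not_less)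
  have len: "length cs = n" using arg_cong[OF assms(2), of length] by simp
  have cs: "cs ! i = inversions \<pi> (i + 2)" if "i < n" for i
    using nth_lehmer_one_line[of "i + 1" "n + 1" \<pi>] that unfolding assms(2) by simp
  obtain i0 where "1 \<le> i0" "i0 < i + 2" "\<pi> (i + 2) < \<pi> i0" "\<pi> i0 < \<pi> (j + 2)" "\<pi> (j + 2) < \<pi> (k + 2)"
    using ex_2134_if_inversions[OF permutes_inj[OF assms(1)], of "i + 2" "j + 2" "k + 2"] * cs len
      by auto
  then have "contains_1243_or_2143 (n + 1) (rc (n + 1) \<pi>)"
    using * len by (intro rc_contains_if_2134[OF assms(1), of i0 "i + 2" "j + 2" "k + 2"]) auto
  then show False using assms(3) by (simp add: schroeder_perms_iff)
qed

section \<open>Paths with shallow codes\<close>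

text \<open>The stack is emptied from the top.\<close>

lemma subseq_stack_code:
  assumes "closes (length st) w"
  shows "subseq st (path_code x st w)"
  using assms
proof (induction x st w rule: path_code.induct)
  case (2 x st w)
  then show ?case using subseq_Cons' by fastforce
next
  case (3 x st w)
  then show ?case by (cases st) auto
qed auto

definition peak :: "nat \<Rightarrow> path" where "peak k = replicate k N @ replicate k E"

lemma code_downs: "length s = k \<Longrightarrow> path_code x (s @ st) (replicate k E @ w) = s @ path_code (x + k) st w"
  by (induction s arbitrary: x k) auto

lemma code_peak: "path_code x st (peak k @ w) = replicate k x @ path_code (x + k) st w"
  unfolding peak_def append_assoc code_ups by (simp add: code_downs)

lemma closes_peak: "closes h (peak k @ w) = closes h w"
proof -
  have "closes h (replicate k N @ w) = closes (k + h) w" for h w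
    by (induction k arbitrary: h) auto
  moreover have "closes (k + h) (replicate k E @ w) = closes h w"
    by (induction k) auto
  ultimately show ?thesis by (simp add: peak_def)
qed

text \<open>Steps that never descend below the starting height do not look at the lower part of the
  stack.\<close>

lemma code_bottom: "closes (length st) u \<Longrightarrow> path_code x (st @ base) u = path_code x st u"
proof (induction x st u rule: path_code.induct)
  case (3 x st w)
  then show ?case by (cases st) auto
qed auto

lemma stack_after_bottom: "closes (length st) u \<Longrightarrow> stack_after x (st @ base) u = base"
proof (induction x st u rule: path_code.induct)
  case (3 x st w)
  then show ?case by (cases st) auto
qed auto

lemma shallow_append: "shallow (as @ bs) \<Longrightarrow> shallow bs"
  by (auto simp: shallow_def intro: list_emb_append2)

text \<open>After an \<open>E\<close> step has been made, a \<open>D\<close> or \<open>N\<close> step before the stack is down to one entry would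
  contribute an entry \<open>d > a\<close> that is followed by \<open>a\<close> and \<open>b\<close>, as these are still on the stack.\<close>

lemma shallow_descent:
  assumes "closes (Suc k) w" "shallow (path_code x (replicate k a @ [b]) w)" "b \<le> a" "a < x"
  shows "\<exists>v. w = replicate k E @ v"
  using assms
proof (induction k arbitrary: x w)
  case (Suc k)
  have pair: "subseq [a, b] (replicate (Suc k) a @ [b])" by (simp add: subseq_drop_many)
  obtain s v where w: "w = s # v" using Suc.prems(1) by (cases w) auto
  show ?case
  proof (cases s)
    case E
    then show ?thesis using Suc.IH[of v "Suc x"] Suc.prems shallow_append[of "[a]"] by (auto simp: w)
  next
    case D
    then have "subseq (replicate (Suc k) a @ [b]) (path_code (Suc x) (replicate (Suc k) a @ [b]) v)"
      using Suc.prems(1) by (intro subseq_stack_code) (simp add: w)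
    then have "subseq [Suc x, a, b] (path_code x (replicate (Suc k) a @ [b]) w)"
      using pair by (auto simp: w D intro: subseq_order.trans)
    then show ?thesis using Suc.prems by (fastforce simp: shallow_def)
  next
    case N
    then have "subseq (x # replicate (Suc k) a @ [b]) (path_code x (x # replicate (Suc k) a @ [b]) v)"
      using Suc.prems(1) by (intro subseq_stack_code) (simp add: w)
    then have "subseq (x # replicate (Suc k) a @ [b]) (path_code x (replicate (Suc k) a @ [b]) w)"
      by (simp add: w N)
    moreover have "subseq [x, a, b] (x # replicate (Suc k) a @ [b])" using pair by auto
    ultimately have "subseq [x, a, b] (path_code x (replicate (Suc k) a @ [b]) w)"
      by (rule subseq_order.trans[rotated])
    then show ?thesis using Suc.prems by (fastforce simp: shallow_def)
  qed
qed simp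

text \<open>While the path rises in column \<open>x\<close>, a \<open>D\<close> step would contribute the entry \<open>x + 1\<close>, which is
  greater than the two or more entries on the stack. So the rise ends with an \<open>E\<close> step, after which
  \<open>shallow_descent\<close> applies.\<close>

lemma shallow_ascent:
  assumes "closes (Suc (Suc k)) w" "shallow (path_code x (replicate (Suc k) x @ [b]) w)" "b \<le> x"
  shows "\<exists>j v. w = replicate j N @ replicate (Suc k + j) E @ v"
  using assms
proof (induction w arbitrary: k)
  case (Cons s w)
  show ?case
  proof (cases s)
    case N
    then obtain j v where "w = replicate j N @ replicate (Suc (Suc k) + j) E @ v"
      using Cons.IH[of "Suc k"] Cons.prems by auto
    then show ?thesis using N by (intro exI[of _ "Suc j"] exI[of _ v]) simp
  next
    case E
    then obtain v where "w = replicate k E @ v"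
      using shallow_descent[of k w "Suc x" x b] Cons.prems shallow_append[of "[x]"] by auto
    then show ?thesis using E by (intro exI[of _ 0] exI[of _ v]) simp
  next
    case D
    have "subseq (replicate (Suc k) x @ [b]) (path_code (Suc x) (replicate (Suc k) x @ [b]) w)"
      using Cons.prems(1) by (intro subseq_stack_code) (simp add: D)
    moreover have "subseq [x, b] (replicate (Suc k) x @ [b])" by (simp add: subseq_drop_many)
    ultimately have "subseq [Suc x, x, b] (path_code x (replicate (Suc k) x @ [b]) (s # w))"
      by (auto simp: D intro: subseq_order.trans)
    then show ?thesis using Cons.prems by (fastforce simp: shallow_def)
  qed
qed simp

text \<open>At height one the path can take a \<open>D\<close> step, make a peak, or return to the diagonal.\<close>

lemma shallow_imp_P_path:
  assumes "closes (Suc 0) w" "shallow (path_code x [b] w)" "b \<le> x"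
  shows "\<exists>q v. w = q @ E # v \<and> q \<in> P_paths \<and> closes 0 q \<and> closes 0 v"
  using assms
proof (induction w arbitrary: x rule: length_induct)
  case (1 w)
  have P_Cons: "t @ q \<in> P_paths" if "q \<in> P_paths" "t = [D] \<or> (\<exists>k>0. t = peak k)" for t q
  proof -
    obtain ws where "q = concat ws" "set ws \<subseteq> {[D]} \<union> {replicate k N @ replicate k E | k. k > 0}"
      using \<open>q \<in> P_paths\<close> by (auto simp: P_paths_def)
    then show ?thesis using that(2) unfolding P_paths_def peak_def
      by (intro CollectI exI[of _ "t # ws"]) auto
  qed
  obtain s u where w: "w = s # u" using 1 by (cases w) auto
  show ?case
  proof (cases s)
    case E
    moreover have "[] \<in> P_paths" unfolding P_paths_def by (intro CollectI exI[of _ "[]"]) simp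
    ultimately show ?thesis using 1 by (intro exI[of _ "[]"] exI[of _ u]) (simp add: w)
  next
    case D
    have "shallow (path_code (Suc x) [b] u)" using 1(3) shallow_append[of "[Suc x]"] by (simp add: w D)
    then obtain q v where "u = q @ E # v" "q \<in> P_paths" "closes 0 q" "closes 0 v"
      using 1(1)[rule_format, of u "Suc x"] 1(2,4) by (auto simp: w D le_SucI)
    then show ?thesis using P_Cons[of q "[D]"] by (intro exI[of _ "D # q"] exI[of _ v]) (simp add: w D)
  next
    case N
    then obtain j v where "u = replicate j N @ replicate (Suc 0 + j) E @ v"
      using shallow_ascent[of 0 u x b] 1 by (auto simp: w)
    then have w': "w = peak (Suc j) @ v" by (simp add: w N peak_def)
    have "closes (Suc 0) v" using 1(2) by (simp add: w' closes_peak)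
    moreover have "shallow (path_code (x + Suc j) [b] v)"
      using 1(3) shallow_append unfolding w' code_peak by blast
    moreover have "length v < length w" by (simp add: w' peak_def)
    ultimately obtain q v' where "v = q @ E # v'" "q \<in> P_paths" "closes 0 q" "closes 0 v'"
      using 1(1)[rule_format, of v "x + Suc j"] 1(4) by auto
    moreover from this have "peak (Suc j) @ q \<in> P_paths"
      using P_Cons[of q "peak (Suc j)"] by blast
    ultimately show ?thesis
      by (intro exI[of _ "peak (Suc j) @ q"] exI[of _ v']) (simp add: w' closes_peak)
  qed
qed

lemma shallow_imp_D_blocks:
  assumes "closes 0 w" "shallow (path_code x [] w)"
  shows "\<exists>ws. set ws \<subseteq> {[D]} \<union> {[N] @ q @ [E] | q. q \<in> P_paths} \<and> w = concat ws"
  using assms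
proof (induction w arbitrary: x rule: length_induct)
  case (1 w)
  show ?case
  proof (cases w)
    case Nil
    then show ?thesis by (intro exI[of _ "[]"]) simp
  next
    case w: (Cons s u)
    show ?thesis
    proof (cases s)
      case E
      then show ?thesis using 1 w by simp
    next
      case D
      have "shallow (path_code (Suc x) [] u)" using 1(3) shallow_append[of "[Suc x]"] by (simp add: w D)
      then obtain ws where "set ws \<subseteq> {[D]} \<union> {[N] @ q @ [E] | q. q \<in> P_paths} \<and> u = concat ws"
        using 1(1)[rule_format, of u "Suc x"] 1(2) by (auto simp: w D)
      then show ?thesis by (intro exI[of _ "[D] # ws"]) (simp add: w D)
    next
      case N
      then obtain q v where u: "u = q @ E # v" "q \<in> P_paths" "closes 0 q" "closes 0 v"
        using shallow_imp_P_path[of u x x] 1 by (auto simp: w)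
      have "shallow (path_code (x + length (path_code x [x] q) + 1) [] v)"
        using 1(3) stack_after_bottom[of "[]" q x "[x]"] u(3) shallow_append[of "path_code x [x] q @
          [x]"]
        by (simp add: w N u(1) code_append)
      moreover have "length v < length w" by (simp add: w u(1))
      ultimately obtain ws where "set ws \<subseteq> {[D]} \<union> {[N] @ q @ [E] | q. q \<in> P_paths} \<and> v = concat ws"
        using 1(1)[rule_format, of v] u(4) by blast
      then show ?thesis using u by (intro exI[of _ "([N] @ q @ [E]) # ws"]) (auto simp: w N)
    qed
  qed
qed

section \<open>Words whose reversed negative has a prescribed code\<close>

lemma code_shift:
  "closes (length st) w \<Longrightarrow> path_code (d + x) (map ((+) d) st) w = map ((+) d) (path_code x st w)"
proof (induction x st w rule: path_code.induct)
  case (3 x st w)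
  then show ?case by (cases st) auto
qed auto

lemma code_from: "closes 0 w \<Longrightarrow> path_code x [] w = map ((+) x) (path_code 0 [] w)"
  using code_shift[of "[]" w x 0] by simp

text \<open>For Lehmer codes this equation describes a skew sum: a word \<open>xs\<close> followed by a word all of
  whose entries are smaller than those of \<open>xs\<close>.\<close>

lemma code_D_split:
  assumes "closes 0 p" "closes 0 q"
  shows "0 # path_code 0 [] (p @ D # q) = (0 # path_code 0 [] p) @ map ((+) (Suc (length (path_code
    0 [] p)))) (0 # path_code 0 [] q)"
  using stack_after_bottom[of "[]" p 0 "[]"] assms(1)
    code_from[OF assms(2), of "Suc (length (path_code 0 [] p))"] by (simp add: code_append)

text \<open>The path is cut at the \<open>E\<close> step that first reaches the diagonal.\<close>

lemma first_return:
  "closes (Suc h) w \<Longrightarrow> \<exists>u v. w = u @ E # v \<and> closes h u \<and> closes 0 v"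
proof (induction w arbitrary: h)
  case (Cons s w)
  show ?case
  proof (cases s)
    case E
    show ?thesis
    proof (cases h)
      case 0
      then show ?thesis using Cons.prems E by (intro exI[of _ "[]"] exI[of _ w]) simp
    next
      case (Suc h')
      then obtain u v where "w = u @ step.E # v" "closes h' u" "closes 0 v"
        using Cons.IH[of h'] Cons.prems E by auto
      then show ?thesis using E Suc by (intro exI[of _ "step.E # u"] exI[of _ v]) simp
    qed
  next
    case N
    then obtain u v where "w = u @ step.E # v" "closes (Suc h) u" "closes 0 v"
      using Cons.IH[of "Suc h"] Cons.prems by auto
    then show ?thesis using N by (intro exI[of _ "step.N # u"] exI[of _ v]) simp
  next
    case D
    then obtain u v where "w = u @ step.E # v" "closes h u" "closes 0 v"
      using Cons.IH[of h] Cons.prems by auto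
    then show ?thesis using D by (intro exI[of _ "step.D # u"] exI[of _ v]) simp
  qed
qed simp

text \<open>The code \<open>0\<close> belongs to the first return of the path to the diagonal, and it is the last \<open>0\<close>.
  The last equation describes the effect of inserting \<open>d\<close> columns after the first \<open>N\<close> step: the
  matching \<open>E\<close> step keeps its code, all other entries are shifted.\<close>

lemma code_block:
  assumes "closes 0 (N # w @ [E])"
  obtains cu cv where "path_code 0 [] (N # w @ [E]) = cu @ 0 # cv" "0 \<notin> set cv"
    "\<And>d. path_code d [0] (w @ [E]) = map ((+) d) cu @ 0 # map ((+) d) cv"
proof -
  obtain u v where uv: "w @ [E] = u @ E # v" "closes 0 u" "closes 0 v"
    using first_return[of 0 "w @ [E]"] assms by auto
  define cu where "cu = path_code 0 [] u"
  define cv where "cv = path_code (Suc (length cu)) [] v"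
  have "path_code d [0] (w @ [E]) = map ((+) d) cu @ 0 # map ((+) d) cv" for d
    using code_bottom[of "[]" u d "[0]"] stack_after_bottom[of "[]" u d "[0]"] uv(2) code_from[OF
      uv(2), of d]
      code_from[OF uv(3), of "Suc (length cu)"] code_from[OF uv(3), of "d + Suc (length cu)"]
    by (simp add: uv(1) code_append cu_def cv_def add_ac)
  moreover from this[of 0] have "path_code 0 [] (N # w @ [E]) = cu @ 0 # cv" by (simp add: map_idI)
  moreover have "0 \<notin> set cv" using code_from[OF uv(3), of "Suc (length cu)"] by (auto simp: cv_def)
  ultimately show ?thesis using that by blast
qed

text \<open>On one-line notations this is the reverse-complement, up to an order-preserving relabeling.
  Real entries leave room for new ones between any two.\<close>

definition neg_rev :: "real list \<Rightarrow> real list" where "neg_rev xs = rev (map uminus xs)"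

lemma neg_rev_append [simp]: "neg_rev (xs @ ys) = neg_rev ys @ neg_rev xs" by (simp add: neg_rev_def)

lemma neg_rev_Cons: "neg_rev (x # xs) = neg_rev xs @ [- x]" by (simp add: neg_rev_def)

lemma neg_rev_Nil [simp]: "neg_rev [] = []" by (simp add: neg_rev_def)

lemma neg_rev_neg_rev [simp]: "neg_rev (neg_rev xs) = xs" by (simp add: neg_rev_def rev_map o_def)

lemma length_neg_rev [simp]: "length (neg_rev xs) = length xs" by (simp add: neg_rev_def)

lemma set_neg_rev: "set (neg_rev xs) = uminus ` set xs" by (simp add: neg_rev_def)

lemma distinct_neg_rev [simp]: "distinct (neg_rev xs) = distinct xs" by (simp add: neg_rev_def
  distinct_map)

text \<open>If \<open>p\<close> and \<open>p'\<close> are Schroeder paths, this says that the permutations with the codes of \<open>p\<close> and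
  \<open>p'\<close> are reverse-complements of each other.\<close>

definition realizes :: "path \<Rightarrow> path \<Rightarrow> bool" where
  "realizes p p' \<longleftrightarrow> (\<exists>xs :: real list. distinct xs \<and>
     lehmer (neg_rev xs) = 0 # path_code 0 [] p \<and> lehmer xs = 0 # path_code 0 [] p')"

lemma realizes_empty: "realizes [] []"
  unfolding realizes_def by (rule exI[of _ "[0]"]) (simp add: neg_rev_Cons)

lemma realizes_NE: "realizes [N, E] [N, E]"
  unfolding realizes_def by (rule exI[of _ "[0, 1]"]) (simp add: neg_rev_Cons)

lemma length_filter_mset: "mset xs = mset ys \<Longrightarrow> length (filter P xs) = length (filter P ys)"
  by (metis mset_filter size_mset)

text \<open>Adding entries above all of \<open>xs\<close> in front raises the whole code.\<close>

lemma lehmer_from_below: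
  assumes "mset pre' = mset pre + mset zs" "\<And>z x. z \<in> set zs \<Longrightarrow> x \<in> set xs \<Longrightarrow> x < z"
  shows "lehmer_from pre' xs = map ((+) (length zs)) (lehmer_from pre xs)"
  using assms
proof (induction xs arbitrary: pre pre')
  case (Cons x xs)
  have "length (filter ((<) x) pre') = length (filter ((<) x) (zs @ pre))"
    using Cons.prems(1) by (intro length_filter_mset) (simp add: add.commute)
  moreover have "filter ((<) x) zs = zs" using Cons.prems(2) by (simp add: filter_id_conv)
  moreover have "lehmer_from (pre' @ [x]) xs = map ((+) (length zs)) (lehmer_from (pre @ [x]) xs)"
    using Cons.prems by (intro Cons.IH) auto
  ultimately show ?case by simp
qed simp

text \<open>By \<open>code_D_split\<close>, a \<open>D\<close> step on the diagonal corresponds to the skew sum of words.\<close>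

lemma lehmer_skew:
  assumes "closes 0 p" "closes 0 q" "lehmer xs = 0 # path_code 0 [] p" "lehmer ys = 0 # path_code 0
    [] q"
    "\<And>x y. x \<in> set xs \<Longrightarrow> y \<in> set ys \<Longrightarrow> y < x"
  shows "lehmer (xs @ ys) = 0 # path_code 0 [] (p @ D # q)"
proof -
  have "length xs = Suc (length (path_code 0 [] p))" using arg_cong[OF assms(3), of length] by simp
  moreover have "lehmer_from xs ys = map ((+) (length xs)) (lehmer ys)"
    using assms(5) by (intro lehmer_from_below) auto
  ultimately show ?thesis
    unfolding lehmer_from_append code_D_split[OF assms(1,2)] assms(3)[symmetric] assms(4)[symmetric]
      by simp
qed

lemma lehmer_add: "lehmer (map ((+) (c::real)) xs) = lehmer xs"
  by (rule lehmer_cong) auto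

text \<open>The reversed negative of a skew sum is the skew sum of the reversed negatives in the opposite
  order.\<close>

lemma realizes_skew:
  assumes "realizes p p'" "realizes q q'" "closes 0 p" "closes 0 p'" "closes 0 q" "closes 0 q'"
  shows "realizes (p @ D # q) (q' @ D # p')"
proof -
  obtain xs ys where xs: "distinct xs" "lehmer (neg_rev xs) = 0 # path_code 0 [] p" "lehmer xs = 0 #
    path_code 0 [] p'"
    and ys: "distinct ys" "lehmer (neg_rev ys) = 0 # path_code 0 [] q" "lehmer ys = 0 # path_code 0
      [] q'"
    using assms by (auto simp: realizes_def)
  obtain c where c: "\<forall>x\<in>set xs. \<forall>y\<in>set ys. x < y + c"
  proof -
    have "finite ((\<lambda>(x, y). x - y) ` (set xs \<times> set ys))" by simp
    then obtain c where "\<forall>d\<in>(\<lambda>(x, y). x - y) ` (set xs \<times> set ys). d < c"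
      by (meson finite_set bdd_above_finite gt_ex bdd_above.E order_le_less_trans)
    then show ?thesis by (intro that[of c]) (fastforce simp: algebra_simps)
  qed
  \<comment> \<open>Raise the second word above the first.\<close>
  let ?ys = "map ((+) c) ys"
  have neg_ys: "neg_rev ?ys = map ((+) (- c)) (neg_rev ys)" by (simp add: neg_rev_def rev_map o_def)
  have "distinct (?ys @ xs)" using xs(1) ys(1) c by (force simp: distinct_map)
  moreover have "lehmer (?ys @ xs) = 0 # path_code 0 [] (q' @ D # p')"
    using assms xs ys c lehmer_add[of c ys] by (intro lehmer_skew) (auto simp: add.commute)
  moreover have "lehmer (neg_rev xs @ neg_rev ?ys) = 0 # path_code 0 [] (p @ D # q)"
    using assms xs ys c lehmer_add[of "-c" "neg_rev ys"] by (intro lehmer_skew) (auto simp: neg_ys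
      set_neg_rev algebra_simps)
  ultimately show ?thesis unfolding realizes_def by (intro exI[of _ "?ys @ xs"]) simp
qed

text \<open>The maximum sits at the last code entry \<open>0\<close>: its own entry is \<open>0\<close>, and all entries after it
  are positive.\<close>

lemma split_at_max:
  assumes "distinct ys" "lehmer ys = cu @ 0 # cv" "0 \<notin> set cv"
  obtains us M vs where "ys = us @ M # vs" "length us = length cu" "\<And>y. y \<in> set us \<union> set vs \<Longrightarrow> y < M"
proof -
  define p where "p = length cu"
  have len: "length ys = p + 1 + length cv" using arg_cong[OF assms(2), of length] by (simp add: p_def)
  have ne: "finite (set ys)" "set ys \<noteq> {}" using len by auto
  obtain i where i: "i < length ys" "ys ! i = Max (set ys)"
    using Max_in[OF ne] by (auto simp: in_set_conv_nth)
  have max: "y \<le> ys ! i" if "y \<in> set ys" for y using that i ne by simp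
  have "lehmer ys ! i = 0"
    using i(1) max by (force simp: nth_lehmer_from filter_empty_conv not_less dest: in_set_takeD)
  have "\<not> p < i"
  proof
    assume "p < i"
    then have "lehmer ys ! i = cv ! (i - p - 1)" "i - p - 1 < length cv"
      using i(1) len by (auto simp: assms(2) nth_append p_def nth_Cons')
    then show False using assms(3) \<open>lehmer ys ! i = 0\<close> by (metis nth_mem)
  qed
  moreover have "\<not> i < p"
  proof
    assume "i < p"
    have "lehmer ys ! p = 0" by (simp add: assms(2) p_def)
    then have "\<forall>y\<in>set (take p ys). y \<le> ys ! p"
      using len by (simp add: nth_lehmer_from filter_empty_conv not_less)
    moreover have "ys ! i \<in> set (take p ys)" using \<open>i < p\<close> i(1) by (auto simp: in_set_conv_nth
      intro!: exI[of _ i])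
    ultimately have "ys ! i \<le> ys ! p" by blast
    moreover have "ys ! p \<le> ys ! i" using max len by simp
    ultimately have "ys ! i = ys ! p" by simp
    then show False using assms(1) \<open>i < p\<close> i(1) len by (simp add: nth_eq_iff_index_eq)
  qed
  ultimately have "i = p" by simp
  define us where "us = take p ys"
  define vs where "vs = drop (Suc p) ys"
  have ys: "ys = us @ ys ! p # vs" using len by (simp add: us_def vs_def id_take_nth_drop)
  moreover have "length us = length cu" using len by (simp add: us_def p_def)
  moreover have "y < ys ! p" if "y \<in> set us \<union> set vs" for y
  proof -
    have "y \<in> set ys" using that by (subst ys) auto
    moreover have "y \<noteq> ys ! p" using that assms(1) ys by (metis Un_iff distinct_append
      distinct.simps(2) disjoint_iff list.set_intros(1))
    ultimately show ?thesis using max \<open>i = p\<close> by fastforce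
  qed
  ultimately show ?thesis using that by blast
qed

text \<open>Room for new entries just below the maximum \<open>M\<close> of a word with other entries \<open>A\<close>.\<close>

lemma ex_increasing_between:
  fixes M :: real
  assumes "finite A" "\<And>y. y \<in> A \<Longrightarrow> y < M"
  obtains zs where "length zs = k" "sorted_wrt (<) zs" "\<And>z. z \<in> set zs \<Longrightarrow> z < M"
    "\<And>y z. y \<in> A \<Longrightarrow> z \<in> set zs \<Longrightarrow> y < z"
proof -
  have "\<exists>zs. length zs = k \<and> sorted_wrt (<) zs \<and> (\<forall>z\<in>set zs. z < M \<and> (\<forall>y\<in>A. y < z))"
    using assms
  proof (induction k arbitrary: A)
    case (Suc k)
    obtain z where z: "z < M" "\<forall>y\<in>A. y < z"
    proof (cases "A = {}")
      case True
      then show ?thesis using that[of "M - 1"] by simp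
    next
      case False
      then have "Max A < M" using Suc.prems by simp
      then obtain z where "Max A < z" "z < M" using dense by blast
      then show ?thesis using that[of z] Suc.prems(1) False by (simp add: Max_less_iff)
    qed
    obtain zs where "length zs = k" "sorted_wrt (<) zs" "\<forall>z'\<in>set zs. z' < M \<and> (\<forall>y\<in>insert z A. y < z')"
      using Suc.IH[of "insert z A"] Suc.prems z by auto
    then show ?case using z by (intro exI[of _ "z # zs"]) auto
  qed simp
  then show ?thesis using that by blast
qed

text \<open>New entries just below the maximum do not affect the earlier entries \<open>as\<close> and the maximum
  itself; they count once each for every other later entry.\<close>

lemma lehmer_insert_below_max:
  assumes ys: "ys = as @ us @ M # vs" and lehmer_ys: "lehmer ys = ca @ cu @ 0 # cv"
    and len: "length ca = length as" "length cu = length us"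
    and zs: "sorted_wrt (<) zs" "\<And>z. z \<in> set zs \<Longrightarrow> z < M" "\<And>y z. y \<in> set (as @ us @ vs) \<Longrightarrow> z \<in> set zs
      \<Longrightarrow> y < z"
  shows "lehmer (as @ zs @ us @ M # vs) =
     ca @ replicate (length zs) 0 @ map ((+) (length zs)) cu @ 0 # map ((+) (length zs)) cv"
proof -
  have eq: "lehmer as @ lehmer_from as us @ length (filter ((<) M) (as @ us)) # lehmer_from (as @ us
    @ [M]) vs = ca @ cu @ 0 # cv"
    using lehmer_ys unfolding ys by (simp add: lehmer_from_append)
  then have as: "lehmer as = ca" and us: "lehmer_from as us = cu"
    and M: "filter ((<) M) (as @ us) = []" and vs: "lehmer_from (as @ us @ [M]) vs = cv"
    using len by (auto simp: append_eq_append_conv)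
  have "lehmer_from as zs = replicate (length zs) 0"
  proof (rule nth_equalityI)
    fix i assume "i < length (lehmer_from as zs)"
    then have i: "i < length zs" by simp
    have "\<not> zs ! i < y" if "y \<in> set (as @ take i zs)" for y
    proof (cases "y \<in> set as")
      case True
      then show ?thesis using zs(3)[of y "zs ! i"] i by auto
    next
      case False
      then have "y \<in> set (take i zs)" using that by simp
      then obtain j where "j < i" "y = zs ! j" using i by (auto simp: in_set_conv_nth)
      then show ?thesis using sorted_wrt_nth_less[OF zs(1), of j i] i by simp
    qed
    then show "lehmer_from as zs ! i = replicate (length zs) 0 ! i"
      using i by (simp add: nth_lehmer_from filter_empty_conv)
  qed simp
  moreover have "lehmer_from (as @ zs) us = map ((+) (length zs)) cu"
    unfolding us[symmetric] using zs(3) by (intro lehmer_from_below) auto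
  moreover have "filter ((<) M) (as @ zs @ us) = []"
    using M zs(2) by (auto simp: filter_empty_conv dest: less_asym)
  moreover have "lehmer_from (as @ zs @ us @ [M]) vs = map ((+) (length zs)) cv"
    unfolding vs[symmetric] using zs(3) by (intro lehmer_from_below) auto
  ultimately show ?thesis by (simp add: lehmer_from_append as)
qed

text \<open>A new entry is put in front of the word, just below its maximum. Of the path \<open>N # w' @ [E]\<close>
  this shifts everything but the \<open>E\<close> step matching the first \<open>N\<close>, which is the effect of a \<open>D\<close> step
  after that \<open>N\<close>. In the reversed negative the new entry comes last and lies just above the minimum,
  so all other entries are larger, as for the appended \<open>N\<close> and \<open>E\<close> steps.\<close>

lemma realizes_valley_level:
  assumes "realizes (N # w @ [E]) (N # w' @ [E])" "closes 0 (N # w' @ [E])"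
  shows "realizes (N # w @ [E, N, E]) (N # D # w' @ [E])"
proof -
  obtain ys where ys: "distinct ys" "lehmer (neg_rev ys) = 0 # path_code 0 [] (N # w @ [E])"
      "lehmer ys = 0 # path_code 0 [] (N # w' @ [E])"
    using assms(1) by (auto simp: realizes_def)
  obtain cu cv where c: "path_code 0 [] (N # w' @ [E]) = cu @ 0 # cv" "0 \<notin> set cv"
    "\<And>d. path_code d [0] (w' @ [E]) = map ((+) d) cu @ 0 # map ((+) d) cv"
    using code_block[OF assms(2)] by blast
  have lehmer_ys: "lehmer ys = (0 # cu) @ 0 # cv" unfolding ys(3) c(1) by simp
  from split_at_max[OF ys(1) this c(2)] obtain us M vs where M: "ys = us @ M # vs" "length us =
    length (0 # cu)"
    "\<And>y. y \<in> set us \<union> set vs \<Longrightarrow> y < M" by blast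
  obtain z where z: "z < M" "\<And>y. y \<in> set us \<union> set vs \<Longrightarrow> y < z"
  proof (rule ex_increasing_between[of "set us \<union> set vs" M 1])
    fix zs assume "length zs = 1" "\<And>z. z \<in> set zs \<Longrightarrow> z < M" "\<And>y z. y \<in> set us \<union> set vs \<Longrightarrow> z \<in> set zs \<Longrightarrow>
      y < z"
    then show thesis using that[of "hd zs"] by (cases zs) auto
  qed (use M(3) in auto)
  have "lehmer ([] @ [z] @ us @ M # vs) = [] @ replicate (length [z]) 0 @ map ((+) (length [z])) (0
    # cu) @ 0 # map ((+) (length [z])) cv"
  proof (rule lehmer_insert_below_max)
    show "ys = [] @ us @ M # vs" using M(1) by simp
    show "lehmer ys = [] @ (0 # cu) @ 0 # cv" using lehmer_ys by simp
  qed (use z M(2) in auto)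
  then have 1: "lehmer (z # ys) = 0 # path_code 0 [] (N # D # w' @ [E])"
    using c(3)[of 1] by (simp add: M(1))
  have "filter ((<) (- z)) (neg_rev ys) = neg_rev vs @ neg_rev us"
    using z by (auto simp: M(1) neg_rev_Cons filter_id_conv set_neg_rev)
  then have "length (filter ((<) (- z)) (neg_rev ys)) = length (path_code 0 [] (N # w @ [E]))"
    using arg_cong[OF ys(2), of length] M(1) by simp
  moreover have "path_code 0 [] ((N # w @ [E]) @ [N, E]) = path_code 0 [] (N # w @ [E]) @ [length
    (path_code 0 [] (N # w @ [E]))]"
    unfolding code_append[of 0 "[]" "N # w @ [E]" "[N, E]"] by simp
  ultimately have 2: "lehmer (neg_rev (z # ys)) = 0 # path_code 0 [] (N # w @ [E, N, E])"
    by (simp add: neg_rev_Cons lehmer_from_append ys(2))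
  have "distinct (z # ys)" using ys(1) z M(1) by force
  with 1 2 show ?thesis unfolding realizes_def by blast
qed

text \<open>A new maximum is put in second place. It has code \<open>0\<close> and raises all later entries, like an
  \<open>E N\<close> after the first \<open>N\<close>. In the reversed negative it is a new minimum in the last place but one;
  its code is that of a \<open>D\<close> step, and the last entry keeps its code.\<close>

lemma realizes_level_valley:
  assumes "realizes (N # w @ [E]) (N # w' @ [E])" "closes 0 (N # w' @ [E])"
  shows "realizes (N # w @ [D, E]) (N # E # N # w' @ [E])"
proof -
  obtain ys where ys: "distinct ys" "lehmer (neg_rev ys) = 0 # path_code 0 [] (N # w @ [E])"
      "lehmer ys = 0 # path_code 0 [] (N # w' @ [E])"
    using assms(1) by (auto simp: realizes_def)
  obtain y0 yr where y: "ys = y0 # yr" using ys(3) by (cases ys) auto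
  obtain z where z: "\<And>y. y \<in> set ys \<Longrightarrow> y < z"
    by (meson finite_set bdd_above_finite gt_ex bdd_above.E order_le_less_trans)
  have "lehmer_from ([y0] @ [z]) yr = map ((+) (length [z])) (lehmer_from [y0] yr)"
    using z by (intro lehmer_from_below) (auto simp: y)
  then have 1: "lehmer (y0 # z # yr) = 0 # path_code 0 [] (N # E # N # w' @ [E])"
    using ys(3) z[of y0] code_from[OF assms(2), of 1] by (simp add: y not_less less_imp_le)
  define cw where "cw = path_code 0 [0] w"
  define c where "c = hd (stack_after 0 [0] w)"
  have eq: "lehmer (neg_rev yr) @ [length (filter ((<) (- y0)) (neg_rev yr))] = (0 # cw) @ [c]"
    using ys(2) by (simp add: y neg_rev_Cons lehmer_from_append code_append cw_def c_def)
  have "length (neg_rev yr) = Suc (length cw)" using arg_cong[OF eq, of length] by simp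
  moreover have "filter ((<) (- z)) (neg_rev yr) = neg_rev yr"
    using z by (auto simp: y filter_id_conv set_neg_rev)
  moreover have "\<not> - y0 < - z" using z[of y0] by (simp add: y)
  ultimately have 2: "lehmer (neg_rev (y0 # z # yr)) = 0 # path_code 0 [] (N # w @ [D, E])"
    using eq by (simp add: neg_rev_Cons lehmer_from_append code_append cw_def[symmetric]
      c_def[symmetric])
  have "distinct (y0 # z # yr)" using ys(1) z by (force simp: y)
  with 1 2 show ?thesis unfolding realizes_def by blast
qed

text \<open>An increasing run of \<open>k\<close> new entries is put after the first entry, just below the maximum. In
  the reversed negative it stands before the last entry, just above the minimum.\<close>

lemma realizes_peak:
  assumes "realizes (N # w @ [E]) (N # w' @ [E])" "closes 0 (N # w' @ [E])"
  shows "realizes (N # w @ peak k @ [E]) (N # peak k @ w' @ [E])"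
proof -
  obtain ys where ys: "distinct ys" "lehmer (neg_rev ys) = 0 # path_code 0 [] (N # w @ [E])"
      "lehmer ys = 0 # path_code 0 [] (N # w' @ [E])"
    using assms(1) by (auto simp: realizes_def)
  obtain cu cv where c: "path_code 0 [] (N # w' @ [E]) = cu @ 0 # cv" "0 \<notin> set cv"
    "\<And>d. path_code d [0] (w' @ [E]) = map ((+) d) cu @ 0 # map ((+) d) cv"
    using code_block[OF assms(2)] by blast
  have lehmer_ys: "lehmer ys = (0 # cu) @ 0 # cv" unfolding ys(3) c(1) by simp
  from split_at_max[OF ys(1) this c(2)] obtain us0 M vs where M0: "ys = us0 @ M # vs" "length us0 =
    length (0 # cu)"
    "\<And>y. y \<in> set us0 \<union> set vs \<Longrightarrow> y < M" by blast
  then obtain y0 us where us0: "us0 = y0 # us" by (cases us0) auto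
  have M: "ys = [y0] @ us @ M # vs" "length us = length cu" "\<And>y. y \<in> set ([y0] @ us @ vs) \<Longrightarrow> y < M"
    using M0 by (auto simp: us0)
  obtain zs where zs: "length zs = k" "sorted_wrt (<) zs" "\<And>z. z \<in> set zs \<Longrightarrow> z < M"
    "\<And>y z. y \<in> set ([y0] @ us @ vs) \<Longrightarrow> z \<in> set zs \<Longrightarrow> y < z"
    using ex_increasing_between[of "set ([y0] @ us @ vs)" M k] M(3) by auto
  let ?yr = "us @ M # vs"
  have "lehmer ([y0] @ zs @ us @ M # vs) = [0] @ replicate (length zs) 0 @ map ((+) (length zs)) cu
    @ 0 # map ((+) (length zs)) cv"
  proof (rule lehmer_insert_below_max[OF M(1)])
    show "lehmer ys = [0] @ cu @ 0 # cv" using lehmer_ys by simp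
  qed (use zs M(2) in auto)
  then have 1: "lehmer (y0 # zs @ ?yr) = 0 # path_code 0 [] (N # peak k @ w' @ [E])"
    using c(3)[of k] by (simp add: zs(1) code_peak)
  define cw where "cw = path_code 0 [0] w"
  define s where "s = stack_after 0 [0] w"
  have eq: "lehmer (neg_rev ?yr) @ [length (filter ((<) (- y0)) (neg_rev ?yr))] = (0 # cw) @ [hd s]"
    using ys(2) by (simp add: M(1) neg_rev_Cons lehmer_from_append code_append cw_def s_def)
  then have eq1: "lehmer (neg_rev ?yr) = 0 # cw" and eq2: "length (filter ((<) (- y0)) (neg_rev
    ?yr)) = hd s"
    unfolding append1_eq_conv by blast+
  have len: "length us + length vs = length cw" using arg_cong[OF eq, of length] by simp
  \<comment> \<open>Each entry of the run has all of \<open>neg_rev ?yr\<close> but its minimum above it, and no earlier one of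
    the run.\<close>
  have "lehmer_from (neg_rev ?yr) (neg_rev zs) = replicate k (length cw)"
  proof (rule nth_equalityI)
    fix i assume "i < length (lehmer_from (neg_rev ?yr) (neg_rev zs))"
    then have i: "i < length (neg_rev zs)" by simp
    then have z: "- (neg_rev zs ! i) \<in> set zs" using nth_mem[OF i] by (auto simp: set_neg_rev)
    have asc: "sorted_wrt (<) (neg_rev zs)" using zs(2) by (simp add: neg_rev_def sorted_wrt_rev
      sorted_wrt_map)
    have "filter ((<) (neg_rev zs ! i)) (take i (neg_rev zs)) = []"
      using sorted_wrt_nth_less[OF asc] i by (force simp: filter_empty_conv in_set_conv_nth)
    moreover have "\<not> neg_rev zs ! i < - M" "\<And>y. y \<in> set us \<union> set vs \<Longrightarrow> neg_rev zs ! i < - y"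
      using zs(3)[OF z] zs(4)[OF _ z] by (force simp: less_minus_iff)+
    then have "filter ((<) (neg_rev zs ! i)) (neg_rev ?yr) = neg_rev vs @ neg_rev us"
      by (auto simp: neg_rev_Cons filter_id_conv set_neg_rev)
    ultimately show "lehmer_from (neg_rev ?yr) (neg_rev zs) ! i = replicate k (length cw) ! i"
      using i len zs(1) by (simp add: nth_lehmer_from)
  qed (simp add: zs(1))
  moreover have "filter ((<) (- y0)) (neg_rev zs) = []"
    using zs(4)[of y0] by (auto simp: filter_empty_conv set_neg_rev less_imp_le not_less)
  moreover have "path_code 0 [] (N # w @ peak k @ [E]) = cw @ replicate k (length cw) @ [hd s]"
    using code_append[of 0 "[0]" w "peak k @ [E]"] by (simp add: code_peak cw_def s_def)
  moreover have "neg_rev (y0 # zs @ ?yr) = neg_rev ?yr @ neg_rev zs @ [- y0]" by (simp add: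
    neg_rev_Cons)
  ultimately have 2: "lehmer (neg_rev (y0 # zs @ ?yr)) = 0 # path_code 0 [] (N # w @ peak k @ [E])"
    using eq1 eq2 by (simp only: lehmer_from_append) simp
  have "distinct zs" using zs(2) by (induction zs) auto
  then have "distinct (y0 # zs @ ?yr)" using ys(1) zs M(1) by force
  with 1 2 show ?thesis unfolding realizes_def by blast
qed

section \<open>Dual paths\<close>

lemma closes_append: "closes h u \<Longrightarrow> closes h (u @ v) = closes 0 v"
  by (induction h u rule: closes.induct) auto

text \<open>The paths \<open>w\<close> and \<open>w'\<close> run along the line \<open>y = x + 1\<close>, and \<open>w'\<close> arises from \<open>w\<close> by \<open>psi\<close> and
  reversal. The valleys \<open>E N\<close> join consecutive blocks \<open>N q E\<close> that have no \<open>D\<close> step in between.\<close>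

inductive dual_interior :: "path \<Rightarrow> path \<Rightarrow> bool" where
  empty: "dual_interior [] []"
| level: "dual_interior w w' \<Longrightarrow> dual_interior (w @ [D]) ([E, N] @ w')"
| valley: "dual_interior w w' \<Longrightarrow> dual_interior (w @ [E, N]) ([D] @ w')"
| peak: "dual_interior w w' \<Longrightarrow> dual_interior (w @ peak k) (peak k @ w')"

text \<open>The second path is \<open>rev_path (psi n p)\<close>, built up alongside \<open>p\<close>. Here \<open>N # w @ [E]\<close> is a
  maximal part without \<open>D\<close> steps on the diagonal, so it starts the path or is preceded by such a
  step.\<close>

inductive dual :: "path \<Rightarrow> path \<Rightarrow> bool" where
  empty: "dual [] []"
| level: "dual p p' \<Longrightarrow> dual (p @ [D]) (D # p')"
| block: "dual_interior w w' \<Longrightarrow> dual (N # w @ [E]) (N # w' @ [E])"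
| level_block: "dual p p' \<Longrightarrow> dual_interior w w' \<Longrightarrow> dual (p @ D # N # w @ [E]) (N # w' @ E # D # p')"

lemma dual_interior_closes:
  assumes "dual_interior w w'"
  shows "closes (Suc 0) (w @ v) = closes (Suc 0) v" "closes (Suc 0) (w' @ v) = closes (Suc 0) v"
  using assms by (induction arbitrary: v rule: dual_interior.induct) (auto simp: closes_peak)

lemma dual_closes:
  assumes "dual p p'"
  shows "closes 0 p" "closes 0 p'"
  using assms
proof (induction rule: dual.induct)
  case (level_block p p' w w')
  { case 1 show ?case using level_block dual_interior_closes by (simp add: closes_append) }
  { case 2 show ?case using level_block dual_interior_closes(2)[OF level_block.hyps(2), of "E # D #
    p'"] by simp }
qed (auto simp: closes_append dual_interior_closes)

lemma dual_interior_realizes: "dual_interior w w' \<Longrightarrow> realizes (N # w @ [E]) (N # w' @ [E])"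
proof (induction rule: dual_interior.induct)
  case empty
  show ?case using realizes_NE by simp
next
  case (level w w')
  then have "closes 0 (N # w' @ [E])" by (simp add: dual_interior_closes)
  then show ?case using realizes_level_valley[OF level.IH] by simp
next
  case (valley w w')
  then have "closes 0 (N # w' @ [E])" by (simp add: dual_interior_closes)
  then show ?case using realizes_valley_level[OF valley.IH] by simp
next
  case (peak w w' k)
  then have "closes 0 (N # w' @ [E])" by (simp add: dual_interior_closes)
  then show ?case using realizes_peak[OF peak.IH] by simp
qed

lemma dual_realizes: "dual p p' \<Longrightarrow> realizes p p'"
proof (induction rule: dual.induct)
  case empty
  then show ?case by (rule realizes_empty)
next
  case (level p p')
  then show ?case using realizes_skew[OF level.IH realizes_empty] dual_closes[OF level.hyps] by simp
next
  case (block w w')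
  then show ?case by (rule dual_interior_realizes)
next
  case (level_block p p' w w')
  then show ?case
    using realizes_skew[OF level_block.IH dual_interior_realizes[OF level_block.hyps(2)]]
      dual_closes[OF level_block.hyps(1)]
    by (simp add: dual_interior_closes[OF level_block.hyps(2)])
qed

lemma dual_interior_append_P:
  assumes "dual_interior w w'" "set ws \<subseteq> {[D]} \<union> {replicate k N @ replicate k E | k. k > 0}"
  shows "\<exists>w''. dual_interior (w @ concat ws) w''"
  using assms
proof (induction ws arbitrary: w w')
  case (Cons t ws)
  then have "t = [D] \<or> (\<exists>k. t = peak k)" by (auto simp: peak_def)
  then obtain w'' where "dual_interior (w @ t) w''"
    using Cons.prems(1) dual_interior.level dual_interior.peak by blast
  then show ?case using Cons.IH[of "w @ t" w''] Cons.prems(2) by auto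
qed auto

text \<open>A block \<open>N q E\<close> is appended to a path. If the path ends with a block already, the two are
  merged, which creates a valley.\<close>

lemma dual_extend_block:
  assumes "dual p p'" "q \<in> P_paths"
  shows "\<exists>p''. dual (p @ [N] @ q @ [E]) p''"
proof -
  obtain ws where ws: "q = concat ws" "set ws \<subseteq> {[D]} \<union> {replicate k N @ replicate k E | k. k > 0}"
    using assms(2) by (auto simp: P_paths_def)
  obtain q' where q': "dual_interior q q'"
    using dual_interior_append_P[OF dual_interior.empty ws(2)] ws(1) by auto
  have ext: "\<exists>w''. dual_interior (w @ [E, N] @ q) w''" if "dual_interior w w'" for w w'
    using dual_interior_append_P[OF dual_interior.valley[OF that] ws(2)] ws(1) by auto
  from assms(1) show ?thesis
  proof cases
    case empty
    then show ?thesis using dual.block[OF q'] by auto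
  next
    case (level p0 p0')
    then show ?thesis using dual.level_block[OF level(3) q'] by auto
  next
    case (block w w')
    then show ?thesis using ext[OF block(3)] dual.block by fastforce
  next
    case (level_block p0 p0' w w')
    then show ?thesis using ext[OF level_block(4)] dual.level_block[OF level_block(3)] by fastforce
  qed
qed

lemma D_path_dual:
  assumes "p \<in> D_paths n"
  shows "\<exists>p'. dual p p'"
proof -
  have "\<exists>p'. dual (concat ws) p'" if "set ws \<subseteq> {[D]} \<union> {[N] @ q @ [E] | q. q \<in> P_paths}" for ws
    using that
  proof (induction ws rule: rev_induct)
    case (snoc t ws)
    then obtain p' where p': "dual (concat ws) p'" by auto
    from snoc.prems consider "t = [D]" | q where "t = [N] @ q @ [E]" "q \<in> P_paths" by auto
    then show ?case
    proof cases
      case 1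
      then show ?thesis using dual.level[OF p'] by auto
    next
      case 2
      then show ?thesis using dual_extend_block[OF p' 2(2)] by simp
    qed
  qed (use dual.empty in auto)
  then show ?thesis using assms by (auto simp: D_paths_def)
qed

lemma psi_from_E: "y \<noteq> x + 1 \<Longrightarrow> psi_from n x y (E # w) = E # psi_from n (x + 1) y w"
  by (cases "(n, x, y, E # w)" rule: psi_from.cases) auto

lemma psi_from_E_not_N: "(\<And>v. w \<noteq> N # v) \<Longrightarrow> psi_from n x y (E # w) = E # psi_from n (x + 1) y w"
  by (cases "(n, x, y, E # w)" rule: psi_from.cases) auto

text \<open>The \<open>E\<close> steps of a peak on the line \<open>y = x + 1\<close> start at height at least two, so none of them
  is part of a feature.\<close>

lemma psi_from_peak: "psi_from n x (x + 1) (peak k @ w) = peak k @ psi_from n (x + k) (x + k + 1) w"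
proof -
  have up: "psi_from n x y (replicate k N @ v) = replicate k N @ psi_from n x (y + k) v" for y v
    by (induction k arbitrary: y) auto
  have down: "psi_from n x (x + 1 + k) (replicate k E @ v) = replicate k E @ psi_from n (x + k) (x +
    1 + k) v" for v x
  proof (induction k arbitrary: x)
    case (Suc k)
    then show ?case using Suc.IH[of "x + 1"] by (simp add: psi_from_E)
  qed simp
  show ?thesis using up down by (simp add: peak_def)
qed

lemma rev_path_append: "rev_path (u @ v) = rev_path v @ rev_path u"
  by (simp add: rev_path_def)

lemma rev_path_rev_path: "rev_path (rev_path p) = p"
proof -
  have "swap_step (swap_step s) = s" for s by (cases s) auto
  then show ?thesis by (simp add: rev_path_def rev_map o_def)
qed

lemma rev_path_peak: "rev_path (peak k) = peak k"
  by (simp add: rev_path_def peak_def)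

text \<open>The bound on the end of \<open>w\<close> ensures that the features lie at \<open>t \<le> n - 1\<close>.\<close>

lemma psi_dual_interior:
  assumes "dual_interior w w'" "x + fst (endpoint w) + 1 \<le> n"
  shows "psi_from n x (x + 1) (w @ v) =
    rev_path w' @ psi_from n (x + fst (endpoint w)) (x + fst (endpoint w) + 1) v"
  using assms
proof (induction arbitrary: v rule: dual_interior.induct)
  case empty
  then show ?case by (simp add: rev_path_def)
next
  case (level w w')
  then show ?case using level.IH[of "D # v"]
    by (auto simp: endpoint_append endpoint_Cons rev_path_append) (auto simp: rev_path_def)
next
  case (valley w w')
  then show ?case using valley.IH[of "E # N # v"]
    by (auto simp: endpoint_append endpoint_Cons rev_path_append) (auto simp: rev_path_def)
next
  case (peak w w' k)
  have "count_list (replicate k a) b = (if a = b then k else 0)" for a b :: step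
    by (induction k) auto
  then have "endpoint (peak k) = (k, k)" by (simp add: endpoint_def peak_def)
  then show ?case using peak.IH[of "peak k @ v"] peak.prems psi_from_peak[of n "x + fst (endpoint
    w)" k v]
    by (simp add: endpoint_append rev_path_append rev_path_peak add.assoc)
qed

text \<open>The path \<open>v\<close> must not begin with \<open>N\<close>, since the final \<open>E\<close> step of \<open>p\<close> would form a notch
  feature with it.\<close>

lemma psi_dual:
  assumes "dual p p'" "fst (endpoint (p @ v)) \<le> n" "\<And>u. v \<noteq> N # u"
  shows "psi_from n 0 0 (p @ v) = rev_path p' @ psi_from n (fst (endpoint p)) (fst (endpoint p)) v"
  using assms
proof (induction arbitrary: v rule: dual.induct)
  case empty
  then show ?case by (simp add: rev_path_def)
next
  case (level p p')
  then show ?case using level.IH[of "D # v"]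
    by (auto simp: endpoint_append endpoint_Cons rev_path_def)
next
  case (block w w')
  then show ?case using psi_dual_interior[OF block.hyps, of 0 n "E # v"] psi_from_E_not_N[of v n]
    by (auto simp: endpoint_append endpoint_Cons rev_path_def)
next
  case (level_block p p' w w')
  let ?x = "fst (endpoint p)"
  have "psi_from n 0 0 (p @ D # N # w @ E # v) = rev_path p' @ psi_from n ?x ?x (D # N # w @ E # v)"
    using level_block by (intro level_block.IH) (auto simp: endpoint_append endpoint_Cons)
  then show ?case
    using psi_dual_interior[OF level_block.hyps(2), of "?x + 1" n "E # v"] psi_from_E_not_N[of v n]
      level_block.prems
    by (auto simp: endpoint_append endpoint_Cons rev_path_def)
qed

lemma dual_eq_rev_psi:
  assumes "dual p p'" "fst (endpoint p) \<le> n"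
  shows "p' = rev_path (psi n p)"
  using psi_dual[OF assms(1), of "[]" n] assms(2) by (simp add: psi_def rev_path_rev_path)

section \<open>Reverse-complements of the permutations of D-paths\<close>

lemma lehmer_rc:
  fixes xs :: "real list"
  assumes \<sigma>: "\<sigma> permutes {1..m}" and eq: "lehmer xs = lehmer (one_line m \<sigma>)" and "distinct xs"
  shows "lehmer (one_line m (rc m \<sigma>)) = lehmer (rev (map uminus xs))"
proof (rule lehmer_cong)
  have len: "length xs = m" using arg_cong[OF eq, of length] by simp
  then show "length (one_line m (rc m \<sigma>)) = length (rev (map uminus xs))" by simp
  fix i j assume "i < length (one_line m (rc m \<sigma>))" "j < length (one_line m (rc m \<sigma>))"
  then have ij: "i < m" "j < m" by simp_all
  have "xs ! (m - Suc j) < xs ! (m - Suc i) \<longleftrightarrow> \<sigma> (m - j) < \<sigma> (m - i)"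
    using lehmer_eq_imp_same_order[OF eq assms(3) distinct_one_line[OF \<sigma>], of "m - Suc j" "m - Suc
      i"] ij len
    by (simp add: nth_one_line del: upt_Suc) (simp add: Suc_diff_Suc)
  moreover have "\<sigma> (m - j) \<in> {1..m}" "\<sigma> (m - i) \<in> {1..m}"
    using permutes_in_image[OF \<sigma>] ij by auto
  moreover have "m + 1 - b < m + 1 - a \<longleftrightarrow> a < b" if "a \<in> {1..m}" "b \<in> {1..m}" for a b
    using that by auto
  ultimately show "one_line m (rc m \<sigma>) ! i < one_line m (rc m \<sigma>) ! j \<longleftrightarrow>
      rev (map uminus xs) ! i < rev (map uminus xs) ! j"
    using ij len by (simp add: nth_one_line rev_nth rc_def)
qed

text \<open>A word realizing the pair \<open>p\<close>, \<open>rev_path (psi n p)\<close> has the same relative order as \<open>phi n p\<close>,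
  so both have reverse-complements with the same Lehmer code.\<close>

lemma phi_rev_psi:
  assumes "p \<in> D_paths n"
  shows "rev_path (psi n p) \<in> schroeder_paths n \<and> phi n (rev_path (psi n p)) = rc (n + 1) (phi n p)"
proof -
  have p: "p \<in> schroeder_paths n" using assms by (simp add: D_paths_def)
  obtain p' where p': "dual p p'" using D_path_dual[OF assms] by blast
  have "fst (endpoint p) = n" using p by (simp add: schroeder_paths_def)
  then have eq: "p' = rev_path (psi n p)" using dual_eq_rev_psi[OF p'] by simp
  obtain xs where xs: "distinct xs" "lehmer (neg_rev xs) = 0 # path_code 0 [] p" "lehmer xs = 0 #
    path_code 0 [] p'"
    using dual_realizes[OF p'] by (auto simp: realizes_def)
  have "length (path_code 0 [] p') = length (path_code 0 [] p)"
    using arg_cong[OF xs(2), of length] arg_cong[OF xs(3), of length] by simp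
  then have p'_path: "p' \<in> schroeder_paths n"
    using p dual_closes(2)[OF p'] by (simp add: schroeder_paths_iff)
  note phi_p = phi_permutes_and_lehmer[OF p] and phi_p' = phi_permutes_and_lehmer[OF p'_path]
  have "lehmer (one_line (n + 1) (rc (n + 1) (phi n p))) = lehmer (rev (map uminus (neg_rev xs)))"
    using xs(1,2) phi_p by (intro lehmer_rc) auto
  also have "\<dots> = lehmer (one_line (n + 1) (phi n p'))"
    using phi_p'(2) xs(3) neg_rev_neg_rev[of xs] unfolding neg_rev_def by simp
  finally have "rc (n + 1) (phi n p) = phi n p'"
    by (intro lehmer_determines_perm[OF rc_permutes[OF phi_p(1)] phi_p'(1)])
  then show ?thesis using p'_path eq by simp
qed

theorem theorem3p9:
  fixes n :: nat and \<pi> :: "nat \<Rightarrow> nat"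
  assumes "\<pi> \<in> schroeder_perms (n + 1)"
  shows "(rc (n + 1) \<pi> \<in> schroeder_perms (n + 1) \<longleftrightarrow> phi_inv n \<pi> \<in> D_paths n)
       \<and> (phi_inv n \<pi> \<in> D_paths n \<longrightarrow>
            phi_inv n (rc (n + 1) \<pi>) = rev_path (psi n (phi_inv n \<pi>)))"
proof -
  have inv: "phi_inv n (phi n q) = q" if "q \<in> schroeder_paths n" for q
    unfolding phi_inv_def using inj_on_phi that by (rule inv_into_f_f)
  obtain p where p: "p \<in> schroeder_paths n" "phi n p = \<pi>" using ex_path_with_phi[OF assms] by blast
  have p_inv: "phi_inv n \<pi> = p" using inv[OF p(1)] p(2) by simp
  have "p \<in> D_paths n" if "rc (n + 1) \<pi> \<in> schroeder_perms (n + 1)"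
  proof -
    have "shallow (path_code 0 [] p)"
      using rc_avoids_imp_shallow[OF phi_permutes_and_lehmer[OF p(1)]] that p(2) by simp
    then show ?thesis
      using shallow_imp_D_blocks[of p 0] p(1) by (auto simp: D_paths_def schroeder_paths_iff)
  qed
  moreover have "rc (n + 1) \<pi> \<in> schroeder_perms (n + 1)" "phi_inv n (rc (n + 1) \<pi>) = rev_path (psi n p)"
    if "p \<in> D_paths n"
    using phi_rev_psi[OF that] phi_in_schroeder_perms inv p(2) by fastforce+
  ultimately show ?thesis unfolding p_inv by blast
qed

end
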